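(* Let $A\in\mathbb{R}^{n\times n}$, $B\in\mathbb{R}^{n\times p}$, $C\in\mathbb{R}^{m\times n}$, and let $R\in\mathbb{R}^{p\times p}$ be symmetric positive definite. Suppose $(A,B)$ is controllable and $(A,C)$ is observable, and let $P_\#$ be the unique positive definite solution (which exists under these hypotheses) of the continuous-time algebraic Riccati equation $$A^\top P+PA-PBR^{-1}B^\top P+C^\top C=0.$$ Then there exists $\alpha>0$ such that, for every $P_0\in\mathbb{S}_+^n\setminus\{0\}$, the solution $P(t)$ of $$\dot P=\alpha A^\top P+\alpha PA-\frac{1}{\mathrm{tr}(P)}PBR^{-1}B^\top P+\alpha^2\,\mathrm{tr}(P)\,C^\top C,\qquad P(0)=P_0,$$ satisfies $d_{\mathcal H}(P(t),P_\#)\to0$ as $t\to\infty$.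
   Context: $\mathbb{S}_+^n$ is the cone of real symmetric positive semidefinite $n\times n$ matrices, and $X\preceq Y$ means $Y-X\in\mathbb{S}_+^n$. The pair $(A,C)$ is observable if the stacked matrix $\mathrm{col}(C,CA,\dots,CA^{n-1})$ has full (column) rank $n$; $(A,B)$ is controllable if $[B,AB,\dots,A^{n-1}B]$ has rank $n$. For $X,Y\in\mathbb{S}_+^n\setminus\{0\}$ let $M(X/Y)=\inf\{\lambda: X\preceq\lambda Y\}$ and $m(X/Y)=\sup\{\mu:\mu Y\preceq X\}$. The Hilbert metric is $d_{\mathcal H}(X,Y)=\ln\frac{M(X/Y)}{m(X/Y)}\in[0,\infty]$, with value $+\infty$ if $M(X/Y)=\infty$ or $m(X/Y)=0$. *)

theory Defs
  imports "HOL-Analysis.Analysis"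
begin

definition psd_cone :: "(real^'n^'n) set" where
  "psd_cone = {X. transpose X = X \<and> (\<forall>x. 0 \<le> x \<bullet> (X *v x))}"

definition pos_def :: "real^'n^'n \<Rightarrow> bool" where
  "pos_def X \<longleftrightarrow> transpose X = X \<and> (\<forall>x. x \<noteq> 0 \<longrightarrow> 0 < x \<bullet> (X *v x))"

definition loewner_le :: "real^'n^'n \<Rightarrow> real^'n^'n \<Rightarrow> bool"  (infix "\<preceq>\<^sub>L" 50) where
  "X \<preceq>\<^sub>L Y \<longleftrightarrow> Y - X \<in> psd_cone"

text \<open>The power \<open>^\<close> inherited from \<open>*\<close> on vectors would be componentwise, hence a separate
  matrix power.\<close>

primrec matpow :: "real^'n^'n \<Rightarrow> nat \<Rightarrow> real^'n^'n" where
  "matpow A 0 = mat 1"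
| "matpow A (Suc k) = A ** matpow A k"

text \<open>The blocks \<open>C A\<^sup>k\<close> and \<open>A\<^sup>k B\<close> with \<open>k < n = CARD('n)\<close> are indexed by \<open>'n\<close> itself, through the
  bijection \<open>to_nat_on UNIV\<close> from \<open>'n\<close> onto \<open>{..<CARD('n)}\<close>. The order of the
  blocks, which does not affect the rank, is thus left unspecified.\<close>

definition observability_matrix :: "real^'n^'n \<Rightarrow> real^'n^'m \<Rightarrow> real^'n^('n \<times> 'm)" where
  "observability_matrix A C =
     (\<chi> r. row (snd r) (C ** matpow A (to_nat_on UNIV (fst r))))"

definition observable :: "real^'n^'n \<Rightarrow> real^'n^'m \<Rightarrow> bool" where
  "observable A C \<longleftrightarrow> rank (observability_matrix A C) = CARD('n)"

definition controllability_matrix :: "real^'n^'n \<Rightarrow> real^'p^'n \<Rightarrow> real^('n \<times> 'p)^'n" where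
  "controllability_matrix A B =
     (\<chi> i c. (matpow A (to_nat_on UNIV (fst c)) ** B) $ i $ snd c)"

definition controllable :: "real^'n^'n \<Rightarrow> real^'p^'n \<Rightarrow> bool" where
  "controllable A B \<longleftrightarrow> rank (controllability_matrix A B) = CARD('n)"

text \<open>The bounds are extended reals so that the infimum of the empty set is \<open>\<infinity>\<close>. The three
  functions below are meant for nonzero arguments in \<^const>\<open>psd_cone\<close>.\<close>

definition hilbert_M :: "real^'n^'n \<Rightarrow> real^'n^'n \<Rightarrow> ereal" where
  "hilbert_M X Y = Inf {ereal l |l. X \<preceq>\<^sub>L l *\<^sub>R Y}"

definition hilbert_m :: "real^'n^'n \<Rightarrow> real^'n^'n \<Rightarrow> ereal" where
  "hilbert_m X Y = Sup {ereal u |u. u *\<^sub>R Y \<preceq>\<^sub>L X}"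

definition hilbert_metric :: "real^'n^'n \<Rightarrow> real^'n^'n \<Rightarrow> ereal" where
  "hilbert_metric X Y =
     (if hilbert_M X Y = \<infinity> \<or> hilbert_m X Y = 0 then \<infinity>
      else ereal (ln (real_of_ereal (hilbert_M X Y) / real_of_ereal (hilbert_m X Y))))"

definition care ::
  "real^'n^'n \<Rightarrow> real^'p^'n \<Rightarrow> real^'n^'m \<Rightarrow> real^'p^'p \<Rightarrow> real^'n^'n \<Rightarrow> bool" where
  "care A B C R P \<longleftrightarrow>
     transpose A ** P + P ** A - P ** B ** matrix_inv R ** transpose B ** P
       + transpose C ** C = 0"

text \<open>The condition \<open>trace (P t) \<noteq> 0\<close> keeps the solution in the domain of the right-hand side,
  where the division is not the conventional \<open>1 / 0 = 0\<close>. The derivative at \<open>0\<close> is one-sided.\<close>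

definition scaled_riccati_solution ::
  "real^'n^'n \<Rightarrow> real^'p^'n \<Rightarrow> real^'n^'m \<Rightarrow> real^'p^'p \<Rightarrow> real \<Rightarrow> real^'n^'n \<Rightarrow>
    (real \<Rightarrow> real^'n^'n) \<Rightarrow> bool" where
  "scaled_riccati_solution A B C R \<alpha> P0 P \<longleftrightarrow>
     P 0 = P0 \<and>
     (\<forall>t\<ge>0. trace (P t) \<noteq> 0 \<and>
        (P has_vector_derivative
           \<alpha> *\<^sub>R (transpose A ** P t) + \<alpha> *\<^sub>R (P t ** A)
           - (1 / trace (P t)) *\<^sub>R (P t ** B ** matrix_inv R ** transpose B ** P t)
           + (\<alpha>\<^sup>2 * trace (P t)) *\<^sub>R (transpose C ** C)) (at t within {0..}))"

end

theory Submission
  imports Defs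
begin

text \<open>
  With \<open>S = B R\<^sup>-\<^sup>1 B\<^sup>T\<close>, \<open>Q = C\<^sup>T C\<close> and \<open>\<alpha> = 1 / trace P\<^sub>#\<close> every positive multiple of \<open>P\<^sub>#\<close> is an equilibrium.
  The difference \<open>D\<close> of two solutions satisfies a linear equation
  \<open>D' = \<Phi>\<^sup>T D + D \<Phi> + trace D \<cdot> K\<close> with \<open>K \<succeq> \<alpha>\<^sup>2 Q\<close>, so the flow preserves the Loewner order. A kernel vector
  of \<open>D\<close> at a later time, transported backwards, stays in the kernel, is annihilated by \<open>C\<close> and
  moves by \<open>\<alpha> A\<close> alone, hence vanishes by observability: the flow is strongly order preserving.
  Let \<open>L\<close> be the infimum of all \<open>l\<close> with \<open>P t \<preceq> l P\<^sub>#\<close> for some \<open>t\<close>. A limit point of \<open>P\<close> is at most \<open>L P\<^sub>#\<close>;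
  if it were different, then one time unit later it would be strictly below \<open>L P\<^sub>#\<close>,
  contradicting the choice of \<open>L\<close>. So \<open>P\<close> converges to \<open>L P\<^sub>#\<close>, and \<open>L > 0\<close> because \<open>P 1\<close> is already
  positive definite.
\<close>

subsection \<open>Ordinary differential equations\<close>

lemma at_within_atLeast_eq_Icc:
  fixes a t :: real
  assumes "t < b"
  shows "at t within {a..} = at t within {a..b}"
  by (rule at_within_nhd[where S = "{..<b}"]) (use assms in auto)

text \<open>The integral of \<open>K * exp (2 * K * s)\<close> is
  \<open>(exp (2 * K * t) - 1) / 2\<close>; this is the source of the contraction factor
  1/2.\<close>

lemma weighted_integral_bound:
  fixes g :: "real \<Rightarrow> 'a::banach"
  assumes K: "K > 0" and t: "0 \<le> t" and g: "continuous_on {0..} g"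
    and B: "\<And>s. 0 \<le> s \<Longrightarrow> norm (g s) \<le> K * exp (2 * K * s) * B" and B0: "B \<ge> 0"
  shows "norm (exp (-2 * K * t) *\<^sub>R integral {0..t} g) \<le> B / 2"
proof -
  have "((\<lambda>s. K * exp (2 * K * s) * B) has_integral exp (2 * K * t) * B / 2 - exp (2 * K * 0) * B / 2) {0..t}"
    by (rule fundamental_theorem_of_calculus[OF t])
      (use K in \<open>auto intro!: derivative_eq_intros simp: field_simps
          simp flip: has_real_derivative_iff_has_vector_derivative\<close>)
  then have hi: "((\<lambda>s. K * exp (2 * K * s) * B) has_integral (exp (2 * K * t) - 1) * B / 2) {0..t}"
    by (simp add: field_simps)
  have "g integrable_on {0..t}"
    by (rule integrable_continuous_real) (rule continuous_on_subset[OF g], auto)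
  then have "norm (integral {0..t} g) \<le> integral {0..t} (\<lambda>s. K * exp (2 * K * s) * B)"
    by (rule integral_norm_bound_integral) (use hi B in auto)
  also have "\<dots> = (exp (2 * K * t) - 1) * B / 2"
    using hi by (rule integral_unique)
  also have "\<dots> \<le> exp (2 * K * t) * B / 2"
    using B0 by (simp add: left_diff_distrib)
  finally have "exp (-2 * K * t) * norm (integral {0..t} g) \<le> exp (-2 * K * t) * (exp (2 * K * t) * B / 2)"
    by (intro mult_left_mono) auto
  also have "\<dots> = B / 2" by (simp add: exp_minus)
  finally show ?thesis by simp
qed

text \<open>The exponential weight makes the integral operator a contraction of the bounded continuous
  functions on the whole half line.\<close>

lemma ode_global_existence:
  fixes f :: "real \<Rightarrow> 'a::banach \<Rightarrow> 'a"
  assumes K: "K > 0"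
    and cont: "\<And>y. continuous_on {0..} y \<Longrightarrow> continuous_on {0..} (\<lambda>s. f s (y s))"
    and lip: "\<And>s x y. 0 \<le> s \<Longrightarrow> norm (f s x - f s y) \<le> K * norm (x - y)"
    and zero: "\<And>s. 0 \<le> s \<Longrightarrow> f s 0 = 0"
  shows "\<exists>x. x 0 = x0 \<and> (\<forall>t\<ge>0. (x has_vector_derivative f t (x t)) (at t within {0..}))"
proof -
  \<comment> \<open>The substitution \<open>x t = exp (2 * K * t) y t\<close> is built in:
    \<open>G y\<close> is the Picard iterate for \<open>x\<close>, and \<open>T y\<close> the same
    for \<open>y\<close>. With \<open>max 0 t\<close> it extends to negative times, since bounded
    continuous functions live on the whole line.\<close>
  define g where "g y s = f s (exp (2 * K * s) *\<^sub>R y s)" for y :: "real \<Rightarrow> 'a" and s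
  define G where "G y t = x0 + integral {0..t} (g y)" for y t
  define T where "T y t = exp (-2 * K * max 0 t) *\<^sub>R G y (max 0 t)" for y t
  have g_cont: "continuous_on {0..} (g y)" if "continuous_on {0..} y" for y
    unfolding g_def by (intro cont continuous_intros that)
  have g_lip: "norm (g y s - g z s) \<le> K * exp (2 * K * s) * norm (y s - z s)" if "0 \<le> s" for y z s
    using lip[OF that, of "exp (2 * K * s) *\<^sub>R y s" "exp (2 * K * s) *\<^sub>R z s"]
    by (simp add: g_def flip: scaleR_diff_right)
  have g_zero: "g (\<lambda>_. 0) s = 0" if "0 \<le> s" for s
    using zero[OF that] by (simp add: g_def)
  have G_deriv: "(G y has_vector_derivative g y t) (at t within {0..})"
    if "continuous_on {0..} y" "0 \<le> t" for y t
  proof -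
    have "((\<lambda>u. integral {0..u} (g y)) has_vector_derivative g y t) (at t within {0..t+1})"
      by (rule integral_has_vector_derivative)
        (use that in \<open>auto intro: continuous_on_subset[OF g_cont]\<close>)
    then show ?thesis
      unfolding G_def[abs_def] by (auto intro!: derivative_eq_intros simp: at_within_atLeast_eq_Icc[of t "t+1" 0])
  qed
  have T_diff: "norm (T y t - T z t) \<le> B / 2"
    if "continuous_on {0..} y" "continuous_on {0..} z" "\<And>s. norm (y s - z s) \<le> B" for y z t B
  proof -
    let ?m = "max 0 t"
    have int: "g w integrable_on {0..?m}" if "continuous_on {0..} w" for w
      by (rule integrable_continuous_real) (rule continuous_on_subset[OF g_cont[OF that]], auto)
    have "T y t - T z t = exp (-2 * K * ?m) *\<^sub>R integral {0..?m} (\<lambda>s. g y s - g z s)"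
      by (simp add: T_def G_def integral_diff[OF int int] that flip: scaleR_diff_right)
    also have "norm \<dots> \<le> B / 2"
    proof (rule weighted_integral_bound[OF K])
      show "norm (g y s - g z s) \<le> K * exp (2 * K * s) * B" if "0 \<le> s" for s
        by (rule order_trans[OF g_lip[OF that]]) (use \<open>\<And>s. norm (y s - z s) \<le> B\<close> K in auto)
      show "B \<ge> 0" using \<open>\<And>s. norm (y s - z s) \<le> B\<close>[of 0] norm_ge_zero order_trans by blast
    qed (use that in \<open>auto intro!: continuous_intros g_cont\<close>)
    finally show ?thesis .
  qed
  have T_bcontfun: "T (apply_bcontfun y) \<in> bcontfun" for y :: "real \<Rightarrow>\<^sub>C 'a"
  proof (rule bcontfun_normI)
    have "continuous_on {0..} (G y)"
      by (rule continuous_on_vector_derivative[of _ _ "g y"]) (auto intro: G_deriv)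
    then have "continuous_on UNIV (\<lambda>t. G y (max 0 t))"
      by (rule continuous_on_compose2) (auto intro!: continuous_intros)
    then show "continuous_on UNIV (T y)"
      unfolding T_def[abs_def] by (intro continuous_intros) auto
    show "norm (T y t) \<le> norm y / 2 + norm x0" for t
    proof -
      have "norm (T y t - T (\<lambda>_. 0) t) \<le> norm y / 2"
        by (rule T_diff) (auto simp: norm_bounded)
      moreover have "integral {0..max 0 t} (g (\<lambda>_. 0)) = integral {0..max 0 t} (\<lambda>_. 0)"
        by (rule integral_cong) (auto simp: g_zero)
      then have "norm (T (\<lambda>_. 0) t) \<le> norm x0"
        using K by (auto simp: T_def G_def intro!: mult_left_le_one_le)
      ultimately show ?thesis
        by (smt (verit) norm_triangle_sub)
    qed
  qed
  define TT where "TT y = Bcontfun (T (apply_bcontfun y))" for y :: "real \<Rightarrow>\<^sub>C 'a"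
  have TT: "apply_bcontfun (TT y) = T (apply_bcontfun y)" for y
    unfolding TT_def by (simp add: Bcontfun_inverse T_bcontfun)
  have "\<exists>!y. TT y = y"
  proof (rule banach_fix_type[of "1/2"])
    show "\<forall>x y. dist (TT x) (TT y) \<le> 1 / 2 * dist x y"
    proof (intro allI dist_bound)
      fix x y :: "real \<Rightarrow>\<^sub>C 'a" and t
      have "norm (T x t - T y t) \<le> dist x y / 2"
        by (rule T_diff) (auto simp: dist_bounded simp flip: dist_norm)
      then show "dist (TT x t) (TT y t) \<le> 1 / 2 * dist x y"
        by (simp add: TT dist_norm)
    qed
  qed auto
  then obtain y where y: "TT y = y" by blast
  have yT: "y t = T y t" for t using TT[of y] y by simp
  \<comment> \<open>The weights cancel at nonnegative times, so the solution is \<open>G y\<close>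
    rather than the fixed point \<open>y\<close>.\<close>
  have Gy: "G y t = exp (2 * K * t) *\<^sub>R y t" if "0 \<le> t" for t
    using that by (subst yT) (simp add: T_def flip: exp_add)
  show ?thesis
  proof (intro exI conjI allI impI)
    show "G y 0 = x0" by (simp add: G_def)
    show "(G y has_vector_derivative f t (G y t)) (at t within {0..})" if "0 \<le> t" for t
      using G_deriv[of y t] that by (simp add: g_def Gy)
  qed
qed

lemma has_real_derivative_nonneg_imp_le:
  fixes g :: "real \<Rightarrow> real"
  assumes "a \<le> b"
    and der: "\<And>s. a \<le> s \<Longrightarrow> s \<le> b \<Longrightarrow> (g has_real_derivative g' s) (at s within {a..b})"
    and nonneg: "\<And>s. a \<le> s \<Longrightarrow> s \<le> b \<Longrightarrow> 0 \<le> g' s"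
  shows "g a \<le> g b"
proof -
  have "\<exists>s\<in>{a..b}. g b - g a = (b - a) * g' s"
    using mvt_very_simple[OF \<open>a \<le> b\<close>, of g "\<lambda>s. (*) (g' s)"] der
    by (simp add: has_field_derivative_def mult.commute)
  then show ?thesis
    using nonneg \<open>a \<le> b\<close> by (smt (verit) atLeastAtMost_iff mult_nonneg_nonneg)
qed

text \<open>The squared norm is nonincreasing when weighted by \<open>exp (-2 * K * s)\<close> and
  nondecreasing when weighted by \<open>exp (2 * K * s)\<close>. The backward estimate keeps nonzero
  solutions from reaching zero.\<close>

lemma gronwall_two_sided:
  fixes x :: "real \<Rightarrow> 'a::real_inner"
  assumes t: "0 \<le> t"
    and der: "\<And>s. 0 \<le> s \<Longrightarrow> s \<le> t \<Longrightarrow> (x has_vector_derivative x' s) (at s within {0..t})"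
    and bd: "\<And>s. 0 \<le> s \<Longrightarrow> s \<le> t \<Longrightarrow> norm (x' s) \<le> K * norm (x s)"
  shows "norm (x t) \<le> exp (K * t) * norm (x 0)"
    and "norm (x 0) \<le> exp (K * t) * norm (x t)"
proof -
  have ip: "\<bar>x s \<bullet> x' s\<bar> \<le> K * (x s \<bullet> x s)" if "0 \<le> s" "s \<le> t" for s
  proof -
    have "\<bar>x s \<bullet> x' s\<bar> \<le> norm (x s) * norm (x' s)" by (rule Cauchy_Schwarz_ineq2)
    also have "\<dots> \<le> norm (x s) * (K * norm (x s))" by (intro mult_left_mono bd that) auto
    also have "\<dots> = K * (x s \<bullet> x s)" by (simp add: power2_norm_eq_inner[symmetric] power2_eq_square)
    finally show ?thesis .
  qed
  have d: "((\<lambda>s. exp (c * s) * (x s \<bullet> x s)) has_real_derivative exp (c * s) * (2 * (x s \<bullet> x' s) + c * (x s \<bullet> x s)))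
      (at s within {0..t})" if "0 \<le> s" "s \<le> t" for s c
    using der[OF that] unfolding has_vector_derivative_def has_field_derivative_def
    by (auto intro!: derivative_eq_intros simp: fun_eq_iff algebra_simps inner_commute)
  have "- (exp (-(2 * K) * 0) * (x 0 \<bullet> x 0)) \<le> - (exp (-(2 * K) * t) * (x t \<bullet> x t))"
    by (rule has_real_derivative_nonneg_imp_le[OF t DERIV_minus[OF d]])
      (use ip in \<open>force simp: mult_le_0_iff algebra_simps\<close>)+
  then have "(norm (x t))\<^sup>2 \<le> (exp (K * t) * norm (x 0))\<^sup>2"
    by (simp add: power_mult_distrib power2_norm_eq_inner exp_minus field_simps flip: exp_double)
  then show "norm (x t) \<le> exp (K * t) * norm (x 0)"
    by (rule power2_le_imp_le) auto
  have "exp (2 * K * 0) * (x 0 \<bullet> x 0) \<le> exp (2 * K * t) * (x t \<bullet> x t)"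
    by (rule has_real_derivative_nonneg_imp_le[OF t d])
      (use ip in \<open>force simp: zero_le_mult_iff abs_le_iff\<close>)+
  then have "(norm (x 0))\<^sup>2 \<le> (exp (K * t) * norm (x t))\<^sup>2"
    by (simp add: power_mult_distrib power2_norm_eq_inner field_simps flip: exp_double)
  then show "norm (x 0) \<le> exp (K * t) * norm (x t)"
    by (rule power2_le_imp_le) auto
qed

subsection \<open>Positive semidefinite matrices\<close>

lemma bounded_bilinear_matrix_matrix_mult:
  "bounded_bilinear ((**) :: real^'n^'m \<Rightarrow> real^'p^'n \<Rightarrow> real^'p^'m)"
  by (rule bilinear_conv_bounded_bilinear[THEN iffD1])
    (auto simp: bilinear_def matrix_add_ldistrib matrix_matrix_mult_def vec_eq_iff sum.distrib
      algebra_simps sum_distrib_left intro!: linearI)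

lemma bounded_bilinear_matrix_vector_mult:
  "bounded_bilinear ((*v) :: real^'n^'m \<Rightarrow> real^'n \<Rightarrow> real^'m)"
  by (rule bilinear_conv_bounded_bilinear[THEN iffD1])
    (auto simp: bilinear_def matrix_vector_mult_def vec_eq_iff sum.distrib
      algebra_simps sum_distrib_left intro!: linearI)

interpretation mm: bounded_bilinear "(**) :: real^'n^'m \<Rightarrow> real^'p^'n \<Rightarrow> real^'p^'m"
  by (rule bounded_bilinear_matrix_matrix_mult)

interpretation mv: bounded_bilinear "(*v) :: real^'n^'m \<Rightarrow> real^'n \<Rightarrow> real^'m"
  by (rule bounded_bilinear_matrix_vector_mult)

lemma bounded_linear_transpose: "bounded_linear (transpose :: real^'n^'m \<Rightarrow> real^'m^'n)"
  by (rule linear_conv_bounded_linear[THEN iffD1])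
    (auto simp: transpose_def vec_eq_iff intro!: linearI)

lemma bounded_linear_trace: "bounded_linear (trace :: real^'n^'n \<Rightarrow> real)"
  by (rule linear_conv_bounded_linear[THEN iffD1])
    (auto simp: trace_def sum.distrib sum_distrib_left intro!: linearI)

lemmas transpose_add = linear_add[OF bounded_linear.linear[OF bounded_linear_transpose]]
  and transpose_diff = linear_diff[OF bounded_linear.linear[OF bounded_linear_transpose]]
  and transpose_scaleR = linear_scale[OF bounded_linear.linear[OF bounded_linear_transpose]]
  and transpose_zero = linear_0[OF bounded_linear.linear[OF bounded_linear_transpose]]

lemmas trace_diff = linear_diff[OF bounded_linear.linear[OF bounded_linear_trace]]
  and trace_scaleR = linear_scale[OF bounded_linear.linear[OF bounded_linear_trace]]
  and trace_zero = linear_0[OF bounded_linear.linear[OF bounded_linear_trace]]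

lemmas continuous_on_matrix [continuous_intros] =
  mm.continuous_on mv.continuous_on 
  bounded_linear.continuous_on[OF bounded_linear_transpose]
  bounded_linear.continuous_on[OF bounded_linear_trace]

lemmas mm_simps = mm.add_left mm.add_right mm.diff_left mm.diff_right mm.minus_left mm.minus_right
  mm.scaleR_left mm.scaleR_right mm.zero_left mm.zero_right matrix_mul_assoc

lemmas tp_simps = transpose_add transpose_diff transpose_scaleR transpose_zero matrix_transpose_mul transpose_transpose

lemma norm_transpose: "norm (transpose X) = norm (X :: real^'n^'m)"
proof -
  have "(\<Sum>i\<in>UNIV. \<Sum>j\<in>UNIV. (X$j$i)\<^sup>2) = (\<Sum>i\<in>UNIV. \<Sum>j\<in>UNIV. (X$i$j)\<^sup>2)"
    by (rule sum.swap)
  then show ?thesis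
    by (simp add: norm_vec_def L2_set_def transpose_def sum_nonneg)
qed

lemma inner_transpose: "x \<bullet> (transpose A *v y) = (A *v x) \<bullet> (y :: real^'m)" for A :: "real^'n^'m"
  by (metis dot_lmul_matrix inner_commute transpose_matrix_vector)

lemma psd_coneD:
  assumes "X \<in> psd_cone"
  shows psd_cone_transpose: "transpose X = X" and psd_cone_nonneg: "0 \<le> x \<bullet> (X *v x)"
  using assms by (auto simp: psd_cone_def)

lemma psd_cone_inner_commute: "X \<in> psd_cone \<Longrightarrow> x \<bullet> (X *v y) = (X *v x) \<bullet> y"
  using inner_transpose[of x X y] psd_cone_transpose by metis

lemma psd_cone_0: "0 \<in> psd_cone"
  by (simp add: psd_cone_def transpose_zero mv.zero_left)

lemma psd_cone_add: "X \<in> psd_cone \<Longrightarrow> Y \<in> psd_cone \<Longrightarrow> X + Y \<in> psd_cone"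
  by (auto simp: psd_cone_def transpose_add mv.add_left inner_add_right)

lemma psd_cone_scaleR: "X \<in> psd_cone \<Longrightarrow> 0 \<le> c \<Longrightarrow> c *\<^sub>R X \<in> psd_cone"
  by (auto simp: psd_cone_def transpose_scaleR mv.scaleR_left)

lemma psd_cone_congruence:
  fixes S :: "real^'m^'m" and B :: "real^'n^'m"
  assumes "S \<in> psd_cone" shows "transpose B ** S ** B \<in> psd_cone"
proof -
  have "x \<bullet> (transpose B ** S ** B *v x) = (B *v x) \<bullet> (S *v (B *v x))" for x
    by (simp add: inner_transpose del: transpose_matrix_vector flip: matrix_vector_mul_assoc)
  then show ?thesis
    using assms by (auto simp: psd_cone_def tp_simps mm_simps)
qed

lemma psd_cone_mat1: "mat 1 \<in> psd_cone"
  by (simp add: psd_cone_def)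

lemma psd_cone_gram: "transpose C ** C \<in> psd_cone" for C :: "real^'n^'m"
  using psd_cone_congruence[OF psd_cone_mat1, of C] by simp

lemma psd_cone_sandwich: "S \<in> psd_cone \<Longrightarrow> P \<in> psd_cone \<Longrightarrow> P ** S ** P \<in> psd_cone"
  using psd_cone_congruence[of S P] psd_cone_transpose[of P] by simp

lemma closed_psd_cone: "closed (psd_cone :: (real^'n^'n) set)"
proof -
  have "closed {X :: real^'n^'n. transpose X = X}"
    by (intro closed_Collect_eq continuous_intros)
  moreover have "closed {X :: real^'n^'n. \<forall>x. 0 \<le> x \<bullet> (X *v x)}"
    by (intro closed_Collect_all closed_Collect_le continuous_intros)
  ultimately show ?thesis
    unfolding psd_cone_def by (rule closed_Collect_conj)
qed

text \<open>The form is nonnegative at \<open>x + t *\<^sub>R y\<close> for every \<open>t\<close>;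
  the claim is the discriminant condition for this quadratic in \<open>t\<close>.\<close>

lemma psd_cone_Cauchy_Schwarz:
  assumes "X \<in> psd_cone"
  shows "(x \<bullet> (X *v y))\<^sup>2 \<le> (x \<bullet> (X *v x)) * (y \<bullet> (X *v y))"
proof -
  let ?a = "x \<bullet> (X *v x)" and ?b = "x \<bullet> (X *v y)" and ?c = "y \<bullet> (X *v y)"
  have q: "0 \<le> ?a + 2 * t * ?b + t\<^sup>2 * ?c" for t
    using psd_cone_nonneg[OF assms, of "x + t *\<^sub>R y"] psd_cone_inner_commute[OF assms, of x y]
    by (simp add: mv.add_right mv.scaleR_right inner_add_left inner_add_right power2_eq_square
        inner_commute algebra_simps)
  have c: "?c \<ge> 0" by (rule psd_cone_nonneg[OF assms])
  show ?thesis
  proof (cases "?c = 0")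
    case True
    \<comment> \<open>The expression is now affine in \<open>t\<close>, and this \<open>t\<close>
      gives it the value -1 unless \<open>?b = 0\<close>.\<close>
    then have "?b = 0"
      using q[of "- (?a + 1) / (2 * ?b)"] by (cases "?b = 0") (auto simp: field_simps)
    then show ?thesis using True by simp
  next
    case False
    then show ?thesis
      using q[of "- ?b / ?c"] c by (simp add: field_simps power2_eq_square)
  qed
qed

text \<open>Cauchy-Schwarz at \<open>X *v x\<close> and \<open>x\<close> bounds the fourth power of
  the norm of \<open>X *v x\<close> by zero.\<close>

lemma psd_cone_kernel:
  assumes "X \<in> psd_cone" "x \<bullet> (X *v x) = 0"
  shows "X *v x = 0"
  using psd_cone_Cauchy_Schwarz[OF assms(1), of "X *v x" x] assms(2) by simp

text \<open>Cauchy-Schwarz on basis vectors gives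
  \<open>(X$i$j)\<^sup>2 \<le> X$i$i * X$j$j\<close>, and the right-hand sides sum to the square of
  the trace.\<close>

lemma psd_cone_norm_le_trace:
  assumes "X \<in> psd_cone" shows "norm X \<le> trace X"
proof -
  have e: "axis i 1 \<bullet> (X *v axis j 1) = X $ i $ j" for i j
    by (simp add: inner_axis' matrix_vector_mul_component inner_axis)
  have d: "0 \<le> X $ i $ i" for i
    using psd_cone_nonneg[OF assms, of "axis i 1"] by (simp add: e)
  have "(norm X)\<^sup>2 = (\<Sum>i\<in>UNIV. \<Sum>j\<in>UNIV. (X$i$j)\<^sup>2)"
    by (simp add: norm_vec_def L2_set_def sum_nonneg)
  also have "\<dots> \<le> (\<Sum>i\<in>UNIV. \<Sum>j\<in>UNIV. X$i$i * X$j$j)"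
    by (intro sum_mono) (use psd_cone_Cauchy_Schwarz[OF assms, of "axis _ 1" "axis _ 1"] in \<open>simp add: e\<close>)
  also have "\<dots> = (trace X)\<^sup>2"
    by (simp add: trace_def power2_eq_square sum_product)
  finally show ?thesis
    by (rule power2_le_imp_le) (simp add: trace_def d sum_nonneg)
qed

lemma psd_cone_trace_pos: "X \<in> psd_cone \<Longrightarrow> X \<noteq> 0 \<Longrightarrow> 0 < trace X"
  by (rule order_less_le_trans[OF _ psd_cone_norm_le_trace]) auto

lemma psd_cone_trace_nonneg: "X \<in> psd_cone \<Longrightarrow> 0 \<le> trace X"
  using psd_cone_norm_le_trace[of X] norm_ge_zero order_trans by blast

section \<open>Positive definite matrices as interior points of the cone\<close>

lemma pos_def_imp_psd_cone: "pos_def X \<Longrightarrow> X \<in> psd_cone"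
  unfolding pos_def_def psd_cone_def
  by (simp, metis inner_zero_left less_imp_le order_refl)

lemma pos_defI: "X \<in> psd_cone \<Longrightarrow> (\<And>x. X *v x = 0 \<Longrightarrow> x = 0) \<Longrightarrow> pos_def X"
  using psd_cone_kernel[of X] unfolding pos_def_def psd_cone_def
  by (metis (mono_tags, lifting) mem_Collect_eq order_le_less)

lemma pos_def_nonzero: "pos_def X \<Longrightarrow> X \<noteq> 0"
proof
  assume "pos_def X" "X = 0"
  moreover have "axis undefined 1 \<noteq> (0 :: real^'n)" by (simp add: axis_eq_0_iff)
  ultimately show False
    unfolding pos_def_def by (metis inner_zero_right less_irrefl mv.zero_left)
qed

lemma pos_def_coercive:
  fixes X :: "real^'n^'n"
  assumes "pos_def X"
  obtains m where "m > 0" "\<And>x. m * (x \<bullet> x) \<le> x \<bullet> (X *v x)"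
proof -
  have "continuous_on (sphere 0 1) (\<lambda>x. x \<bullet> (X *v x))"
    by (intro continuous_intros)
  moreover have "sphere 0 1 \<noteq> ({} :: (real^'n) set)" by simp
  ultimately obtain u where u: "u \<in> sphere 0 1" and min: "\<And>x. x \<in> sphere 0 1 \<Longrightarrow> u \<bullet> (X *v u) \<le> x \<bullet> (X *v x)"
    using continuous_attains_inf[of "sphere 0 1" "\<lambda>x. x \<bullet> (X *v x)"] by auto
  show thesis
  proof
    show "u \<bullet> (X *v u) > 0"
      using assms u unfolding pos_def_def by (metis norm_zero mem_sphere_0 zero_neq_one)
    show "u \<bullet> (X *v u) * (x \<bullet> x) \<le> x \<bullet> (X *v x)" for x
    proof (cases "x = 0")
      case False
      then have "u \<bullet> (X *v u) \<le> (x /\<^sub>R norm x) \<bullet> (X *v (x /\<^sub>R norm x))"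
        by (intro min) simp
      also have "\<dots> = (x \<bullet> (X *v x)) / (x \<bullet> x)"
        by (simp add: mv.scaleR_right divide_inverse dot_square_norm power2_eq_square)
      finally show ?thesis using False by (simp add: field_simps)
    qed simp
  qed
qed

text \<open>Coercivity absorbs small errors. The cone has interior only relative to the symmetric
  matrices, hence the symmetry of \<open>E\<close>.\<close>

lemma pos_def_perturb:
  fixes X :: "real^'n^'n"
  assumes "pos_def X"
  obtains e where "e > 0" "\<And>E. transpose E = E \<Longrightarrow> norm E \<le> e \<Longrightarrow> X + E \<in> psd_cone"
proof -
  obtain m where m: "m > 0" "\<And>x. m * (x \<bullet> x) \<le> x \<bullet> (X *v x)"
    using pos_def_coercive[OF assms] by blast
  obtain K where K: "K > 0" "\<And>(E :: real^'n^'n) x. norm (E *v x) \<le> norm E * norm x * K"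
    using mv.pos_bounded by blast
  show thesis
  proof
    show "m / K > 0" using m K by simp
    fix E :: "real^'n^'n" assume E: "transpose E = E" "norm E \<le> m / K"
    have "0 \<le> x \<bullet> ((X + E) *v x)" for x
    proof -
      have "\<bar>x \<bullet> (E *v x)\<bar> \<le> norm x * norm (E *v x)" by (rule Cauchy_Schwarz_ineq2)
      also have "\<dots> \<le> norm x * (norm E * norm x * K)" by (intro mult_left_mono K) simp
      also have "\<dots> = norm E * K * (x \<bullet> x)" by (simp add: dot_square_norm power2_eq_square)
      also have "\<dots> \<le> m * (x \<bullet> x)" using E K by (intro mult_right_mono) (auto simp: field_simps)
      finally show ?thesis using m(2)[of x] by (simp add: mv.add_left inner_add_right)
    qed
    then show "X + E \<in> psd_cone"
      using assms E by (auto simp: psd_cone_def pos_def_def transpose_add)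
  qed
qed

lemma pos_def_absorbs:
  fixes X :: "real^'n^'n"
  assumes "pos_def X" "transpose Y = Y"
  obtains e where "e > 0" "X - e *\<^sub>R Y \<in> psd_cone"
proof -
  obtain e where e: "e > 0" "\<And>E. transpose E = E \<Longrightarrow> norm E \<le> e \<Longrightarrow> X + E \<in> psd_cone"
    using pos_def_perturb[OF assms(1)] by blast
  show thesis
  proof
    \<comment> \<open>Adding 1 covers \<open>Y = 0\<close>.\<close>
    show "e / (norm Y + 1) > 0" using e by (simp add: add_nonneg_pos)
    have "X + (- (e / (norm Y + 1))) *\<^sub>R Y \<in> psd_cone"
    proof (rule e(2))
      show "norm ((- (e / (norm Y + 1))) *\<^sub>R Y) \<le> e"
        using e(1) by (simp add: field_simps add_pos_nonneg)
    qed (simp only: transpose_scaleR assms)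
    then show "X - (e / (norm Y + 1)) *\<^sub>R Y \<in> psd_cone" by simp
  qed
qed

lemma pos_def_trace_pos: "pos_def X \<Longrightarrow> 0 < trace X"
  by (intro psd_cone_trace_pos pos_def_imp_psd_cone pos_def_nonzero)

text \<open>The trace detects the sign of \<open>c\<close>. Comparisons between multiples of
  \<open>Y\<close> thus become comparisons of reals.\<close>

lemma pos_def_scaleR_in_psd_cone_iff:
  assumes "pos_def Y" shows "c *\<^sub>R Y \<in> psd_cone \<longleftrightarrow> 0 \<le> c"
  using psd_cone_trace_nonneg[of "c *\<^sub>R Y"] pos_def_trace_pos[OF assms]
    psd_cone_scaleR[OF pos_def_imp_psd_cone[OF assms], of c]
  by (auto simp: trace_scaleR zero_le_mult_iff)

lemma pos_def_absorbs_scaled: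
  fixes X :: "real^'n^'n"
  assumes "pos_def X" "Y \<in> psd_cone"
  obtains l where "l > 0" "l *\<^sub>R X - Y \<in> psd_cone"
proof -
  obtain e where e: "e > 0" "X - e *\<^sub>R Y \<in> psd_cone"
    using pos_def_absorbs[OF assms(1) psd_cone_transpose[OF assms(2)]] by blast
  have "(1 / e) *\<^sub>R (X - e *\<^sub>R Y) \<in> psd_cone"
    using e by (intro psd_cone_scaleR) auto
  then show thesis
    using that[of "1 / e"] e by (simp add: scaleR_diff_right)
qed

subsection \<open>Lyapunov differential equations\<close>

lemma continuous_on_Icc_norm_bound:
  fixes F :: "real \<Rightarrow> 'a::real_normed_vector"
  assumes "continuous_on {a..b} F"
  obtains K where "K > 0" "\<And>s. s \<in> {a..b} \<Longrightarrow> norm (F s) \<le> K"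
proof -
  have "bounded (F ` {a..b})"
    by (intro compact_imp_bounded compact_continuous_image assms compact_Icc)
  then show thesis
    using that by (auto simp: bounded_pos)
qed

text \<open>The scalar \<open>a\<close> is free so that one constant serves forcing by
  \<open>trace Z\<close>, by differences of absolute traces, and by 0.\<close>

lemma lyapunov_operator_bound:
  fixes At K :: "real \<Rightarrow> real^'n^'n"
  assumes "continuous_on {0..T} At" "continuous_on {0..T} K"
  obtains c where "c > 0"
    "\<And>s Z a. s \<in> {0..T} \<Longrightarrow> \<bar>a\<bar> \<le> \<bar>trace Z\<bar> \<Longrightarrow>
      norm (transpose (At s) ** Z + Z ** At s + a *\<^sub>R K s) \<le> c * norm Z"
proof -
  obtain a where a: "a > 0" "\<And>s. s \<in> {0..T} \<Longrightarrow> norm (At s) \<le> a"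
    using continuous_on_Icc_norm_bound[OF assms(1)] by blast
  obtain b where b: "b > 0" "\<And>s. s \<in> {0..T} \<Longrightarrow> norm (K s) \<le> b"
    using continuous_on_Icc_norm_bound[OF assms(2)] by blast
  obtain m where m: "m > 0" "\<And>(X :: real^'n^'n) (Y :: real^'n^'n). norm (X ** Y) \<le> norm X * norm Y * m"
    using mm.pos_bounded by blast
  obtain d where d: "d > 0" "\<And>Z :: real^'n^'n. \<bar>trace Z\<bar> \<le> norm Z * d"
    using bounded_linear.pos_bounded[OF bounded_linear_trace] by auto
  show thesis
  proof
    show "2 * a * m + b * d > 0" using a b m d by (simp add: add_pos_pos)
    fix s and Z :: "real^'n^'n" and r assume s: "s \<in> {0..T}" and r: "\<bar>r\<bar> \<le> \<bar>trace Z\<bar>"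
    have "norm (transpose (At s) ** Z) \<le> a * norm Z * m"
      by (rule order_trans[OF m(2)], unfold norm_transpose) (intro mult_right_mono a s less_imp_le[OF m(1)] norm_ge_zero)
    moreover have "norm (Z ** At s) \<le> norm Z * a * m"
      by (rule order_trans[OF m(2)]) (intro mult_right_mono mult_left_mono a s less_imp_le[OF m(1)] norm_ge_zero)
    moreover have "norm (r *\<^sub>R K s) \<le> (norm Z * d) * b"
      unfolding norm_scaleR real_norm_def
      by (rule mult_mono[OF order_trans[OF r d(2)] b(2)[OF s]]) (use d in auto)
    ultimately show "norm (transpose (At s) ** Z + Z ** At s + r *\<^sub>R K s) \<le> (2 * a * m + b * d) * norm Z"
      using norm_triangle_ineq[of "transpose (At s) ** Z + Z ** At s" "r *\<^sub>R K s"]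
        norm_triangle_ineq[of "transpose (At s) ** Z" "Z ** At s"]
      by (simp add: algebra_simps)
  qed
qed

lemma has_vector_derivative_eq_zero:
  fixes x :: "real \<Rightarrow> 'a::real_normed_vector"
  assumes "a < b" "s \<in> {a..b}" and z: "\<And>r. r \<in> {a..b} \<Longrightarrow> x r = 0"
    and d: "(x has_vector_derivative x') (at s within {a..b})"
  shows "x' = 0"
proof -
  have "((\<lambda>_. 0) has_vector_derivative x') (at s within {a..b})"
    using has_vector_derivative_transform[OF assms(2) _ d, of "\<lambda>_. 0"] z by simp
  then show ?thesis
    using vector_derivative_unique_within_closed_interval[unfolded cbox_interval, OF assms(1,2), of "\<lambda>_. 0" x' 0] by simp
qed

text \<open>The zero at \<open>s\<close> is carried back to time 0 and from there forward to
  \<open>t\<close>. This serves both for uniqueness and to show that a nonzero solution never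
  vanishes.\<close>

lemma gronwall_eq_zero:
  fixes x :: "real \<Rightarrow> 'a::real_inner"
  assumes "\<And>s. s \<in> {0..T} \<Longrightarrow> (x has_vector_derivative x' s) (at s within {0..T})"
    and "\<And>s. s \<in> {0..T} \<Longrightarrow> norm (x' s) \<le> K * norm (x s)"
    and "t \<in> {0..T}" "s \<in> {0..T}" "x s = 0"
  shows "x t = 0"
proof -
  have sub: "(x has_vector_derivative x' r) (at r within {0..u})" if "u \<in> {0..T}" "r \<in> {0..u}" for r u
    by (rule has_vector_derivative_within_subset[OF assms(1)]) (use that in auto)
  have "norm (x 0) \<le> exp (K * s) * norm (x s)"
    by (rule gronwall_two_sided(2)[where x' = x']) (use assms in \<open>auto intro: sub\<close>)
  then have "x 0 = 0" using assms by simp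
  moreover have "norm (x t) \<le> exp (K * t) * norm (x 0)"
    by (rule gronwall_two_sided(1)[where x' = x']) (use assms in \<open>auto intro: sub\<close>)
  ultimately show ?thesis by simp
qed

text \<open>Transporting a vector backwards along the linear flow turns the Lyapunov equation for
  \<open>D\<close> into a scalar monotonicity statement for the quadratic form.\<close>

lemma lyapunov_backward_flow:
  fixes At D Q :: "real \<Rightarrow> real^'n^'n" and v :: "real^'n"
  assumes T: "0 \<le> T" and cA: "continuous_on {0..T} At"
    and D: "\<And>s. s \<in> {0..T} \<Longrightarrow>
      (D has_vector_derivative (transpose (At s) ** D s + D s ** At s + Q s)) (at s within {0..T})"
  shows "\<exists>w. w 0 = v \<and>
    (\<forall>r\<in>{0..T}. (w has_vector_derivative At (T - r) *v w r) (at r within {0..T})) \<and>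
    (\<forall>r\<in>{0..T}. ((\<lambda>r. w r \<bullet> (D (T - r) *v w r)) has_vector_derivative
        - (w r \<bullet> (Q (T - r) *v w r))) (at r within {0..T}))"
proof -
  obtain a where a: "a > 0" "\<And>s. s \<in> {0..T} \<Longrightarrow> norm (At s) \<le> a"
    using continuous_on_Icc_norm_bound[OF cA] by blast
  obtain m where m: "m > 0" "\<And>X (y :: real^'n). norm ((X :: real^'n^'n) *v y) \<le> norm X * norm y * m"
    using mv.pos_bounded by blast
  \<comment> \<open>\<open>max 0 (T - t)\<close> freezes the coefficient once \<open>t\<close>
    exceeds \<open>T\<close>, which makes the equation global in time.\<close>
  have "\<exists>w. w 0 = v \<and> (\<forall>t\<ge>0. (w has_vector_derivative At (max 0 (T - t)) *v w t) (at t within {0..}))"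
  proof (rule ode_global_existence[where K = "a * m"])
    show "continuous_on {0..} (\<lambda>s. At (max 0 (T - s)) *v y s)" if "continuous_on {0..} y" for y
      by (intro continuous_intros that continuous_on_compose2[OF cA]) (use T in auto)
    show "norm (At (max 0 (T - s)) *v x - At (max 0 (T - s)) *v y) \<le> a * m * norm (x - y)"
      if "0 \<le> s" for s x y
    proof -
      have "norm (At (max 0 (T - s)) *v (x - y)) \<le> norm (At (max 0 (T - s))) * norm (x - y) * m"
        by (rule m)
      also have "\<dots> \<le> a * norm (x - y) * m"
        using a(2)[of "max 0 (T - s)"] that T m by (intro mult_right_mono) auto
      finally show ?thesis by (simp add: mv.diff_right mult_ac)
    qed
  qed (use a m in auto)
  then obtain w where w0: "w 0 = v"
    and w: "\<And>t. 0 \<le> t \<Longrightarrow> (w has_vector_derivative At (max 0 (T - t)) *v w t) (at t within {0..})"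
    by blast
  have w': "(w has_vector_derivative At (T - r) *v w r) (at r within {0..T})" if "r \<in> {0..T}" for r
    using has_vector_derivative_within_subset[OF w[of r], of "{0..T}"] that by (simp add: max_def)
  have D': "((\<lambda>r. D (T - r)) has_vector_derivative
     - (transpose (At (T - r)) ** D (T - r) + D (T - r) ** At (T - r) + Q (T - r))) (at r within {0..T})"
    if "r \<in> {0..T}" for r
  proof -
    have im: "(\<lambda>r. T - r) ` {0..T} = {0..T}" by (auto simp: image_iff intro!: bexI[of _ "T - _"])
    have "((\<lambda>r. T - r) has_vector_derivative - 1) (at r within {0..T})"
      by (auto intro!: derivative_eq_intros)
    from vector_diff_chain_within[OF this, of D, unfolded im, OF D[of "T - r"]] that
    show ?thesis by (simp add: o_def)
  qed
  have "((\<lambda>r. w r \<bullet> (D (T - r) *v w r)) has_vector_derivative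
        - (w r \<bullet> (Q (T - r) *v w r))) (at r within {0..T})" if r: "r \<in> {0..T}" for r
  proof -
    have "((\<lambda>r. D (T - r) *v w r) has_vector_derivative
        D (T - r) *v (At (T - r) *v w r)
        + (- (transpose (At (T - r)) ** D (T - r) + D (T - r) ** At (T - r) + Q (T - r))) *v w r)
      (at r within {0..T})"
      by (rule mv.has_vector_derivative[OF D'[OF r] w'[OF r]])
    \<comment> \<open>The two terms \<open>D At w\<close> cancel here; the one with
      \<open>transpose At\<close> cancels below against the derivative of \<open>w\<close> in the
      inner product.\<close>
    then have 1: "((\<lambda>r. D (T - r) *v w r) has_vector_derivative
        - (transpose (At (T - r)) *v (D (T - r) *v w r)) - Q (T - r) *v w r) (at r within {0..T})"
      by (simp add: mv.add_left mv.diff_left mv.minus_left matrix_vector_mul_assoc del: transpose_matrix_vector)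
    show ?thesis
      using bounded_bilinear.has_vector_derivative[OF bounded_bilinear_inner w'[OF r] 1]
      by (simp add: inner_transpose inner_diff_right inner_minus_right del: transpose_matrix_vector)
  qed
  then show ?thesis using w0 w' by blast
qed

text \<open>Along the backward flow the form does not increase between its value for
  \<open>D T\<close> and its nonnegative value for \<open>D 0\<close>. Symmetry is separate: the
  antisymmetric part solves a homogeneous linear equation and starts at zero.\<close>

lemma lyapunov_psd:
  fixes At D Q :: "real \<Rightarrow> real^'n^'n"
  assumes T: "0 \<le> T" and cA: "continuous_on {0..T} At"
    and D: "\<And>s. s \<in> {0..T} \<Longrightarrow>
      (D has_vector_derivative (transpose (At s) ** D s + D s ** At s + Q s)) (at s within {0..T})"
    and Q: "\<And>s. s \<in> {0..T} \<Longrightarrow> Q s \<in> psd_cone"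
    and D0: "D 0 \<in> psd_cone"
  shows "D T \<in> psd_cone"
proof -
  have "0 \<le> v \<bullet> (D T *v v)" for v
  proof -
    obtain w where w: "w 0 = v"
      "\<And>r. r \<in> {0..T} \<Longrightarrow> ((\<lambda>r. w r \<bullet> (D (T - r) *v w r)) has_vector_derivative
        - (w r \<bullet> (Q (T - r) *v w r))) (at r within {0..T})"
      using lyapunov_backward_flow[OF T cA D] by blast
    have "- (w 0 \<bullet> (D (T - 0) *v w 0)) \<le> - (w T \<bullet> (D (T - T) *v w T))"
    proof (rule has_real_derivative_nonneg_imp_le[OF T, where g = "\<lambda>r. - (w r \<bullet> (D (T - r) *v w r))"])
      fix r assume "0 \<le> r" "r \<le> T"
      then show "((\<lambda>r. - (w r \<bullet> (D (T - r) *v w r))) has_real_derivative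
          - (- (w r \<bullet> (Q (T - r) *v w r)))) (at r within {0..T})"
        unfolding has_real_derivative_iff_has_vector_derivative
        by (intro has_vector_derivative_minus w) simp
      show "0 \<le> - (- (w r \<bullet> (Q (T - r) *v w r)))"
        using psd_cone_nonneg[OF Q, of "T - r" "w r"] \<open>0 \<le> r\<close> \<open>r \<le> T\<close> by simp
    qed
    then show ?thesis using psd_cone_nonneg[OF D0, of "w T"] w(1) by simp
  qed
  moreover have "transpose (D T) = D T"
  proof -
    obtain c where c: "\<And>s Z. s \<in> {0..T} \<Longrightarrow>
        norm (transpose (At s) ** Z + Z ** At s) \<le> c * norm Z"
    proof (rule lyapunov_operator_bound[OF cA cA])
      fix c assume c: "\<And>s Z a. s \<in> {0..T} \<Longrightarrow> \<bar>a\<bar> \<le> \<bar>trace Z\<bar> \<Longrightarrow>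
        norm (transpose (At s) ** Z + Z ** At s + a *\<^sub>R At s) \<le> c * norm Z"
      show thesis
        using c[where a = 0] by (intro that[of c]) simp
    qed
    have "D T - transpose (D T) = 0"
    proof (rule gronwall_eq_zero[where x = "\<lambda>s. D s - transpose (D s)" and T = T and s = 0])
      fix s assume s: "s \<in> {0..T}"
      show "((\<lambda>s. D s - transpose (D s)) has_vector_derivative
          transpose (At s) ** (D s - transpose (D s)) + (D s - transpose (D s)) ** At s) (at s within {0..T})"
        using has_vector_derivative_diff[OF D[OF s]
            bounded_linear.has_vector_derivative[OF bounded_linear_transpose D[OF s]]]
          psd_cone_transpose[OF Q[OF s]]
        by (simp add: mm_simps tp_simps algebra_simps)
      show "norm (transpose (At s) ** (D s - transpose (D s)) + (D s - transpose (D s)) ** At s)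
          \<le> c * norm (D s - transpose (D s))"
        by (rule c[OF s])
    qed (use T psd_cone_transpose[OF D0] in auto)
    then show ?thesis by simp
  qed
  ultimately show ?thesis by (simp add: psd_cone_def)
qed

text \<open>The forcing \<open>trace D *\<^sub>R K\<close> is nonnegative only if \<open>D\<close> already is. Replacing the trace by its
  absolute value breaks this circle, and the two equations have the same solution.\<close>

lemma trace_forced_lyapunov_psd:
  fixes At D K :: "real \<Rightarrow> real^'n^'n"
  assumes T: "0 \<le> T" and cA: "continuous_on {0..T} At" and cK: "continuous_on {0..T} K"
    and D: "\<And>s. s \<in> {0..T} \<Longrightarrow>
      (D has_vector_derivative (transpose (At s) ** D s + D s ** At s + trace (D s) *\<^sub>R K s)) (at s within {0..T})"
    and K: "\<And>s. s \<in> {0..T} \<Longrightarrow> K s \<in> psd_cone"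
    and D0: "D 0 \<in> psd_cone"
  shows "D T \<in> psd_cone"
proof -
  obtain c where c: "c > 0" "\<And>s Z a. s \<in> {0..T} \<Longrightarrow> \<bar>a\<bar> \<le> \<bar>trace Z\<bar> \<Longrightarrow>
      norm (transpose (At s) ** Z + Z ** At s + a *\<^sub>R K s) \<le> c * norm Z"
    using lyapunov_operator_bound[OF cA cK] by blast
  define f where "f s Z = transpose (At (min s T)) ** Z + Z ** At (min s T) + \<bar>trace Z\<bar> *\<^sub>R K (min s T)"
    for s Z
  have "\<exists>E. E 0 = D 0 \<and> (\<forall>t\<ge>0. (E has_vector_derivative f t (E t)) (at t within {0..}))"
  proof (rule ode_global_existence[OF c(1)])
    show "continuous_on {0..} (\<lambda>s. f s (y s))" if "continuous_on {0..} y" for y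
      unfolding f_def
      by (intro continuous_intros that continuous_on_compose2[OF cA] continuous_on_compose2[OF cK])
        (use T in auto)
    show "norm (f s X - f s Y) \<le> c * norm (X - Y)" if "0 \<le> s" for s X Y
    proof -
      have "\<bar>\<bar>trace X\<bar> - \<bar>trace Y\<bar>\<bar> \<le> \<bar>trace (X - Y)\<bar>"
        by (simp add: trace_diff abs_triangle_ineq3)
      from c(2)[OF _ this, of "min s T"] that T show ?thesis
        by (simp add: f_def mm_simps algebra_simps)
    qed
  qed (simp add: f_def mm_simps trace_zero)
  then obtain E where E0: "E 0 = D 0"
    and E: "\<And>t. 0 \<le> t \<Longrightarrow> (E has_vector_derivative f t (E t)) (at t within {0..})"
    by blast
  have E': "(E has_vector_derivative
      transpose (At s) ** E s + E s ** At s + \<bar>trace (E s)\<bar> *\<^sub>R K s) (at s within {0..T})" if "s \<in> {0..T}" for s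
    using has_vector_derivative_within_subset[OF E[of s], of "{0..T}"] that by (simp add: f_def)
  have psd: "E t \<in> psd_cone" if t: "t \<in> {0..T}" for t
    by (rule lyapunov_psd[where At = At and Q = "\<lambda>s. \<bar>trace (E s)\<bar> *\<^sub>R K s"])
      (use t E0 D0 in \<open>auto intro!: has_vector_derivative_within_subset[OF E'] psd_cone_scaleR K
        intro: continuous_on_subset[OF cA]\<close>)
  \<comment> \<open>Since \<open>E\<close> stays in the cone, its trace equals its absolute value:
    \<open>E\<close> solves the original equation, and the difference a homogeneous linear
    one.\<close>
  have "D T - E T = 0"
  proof (rule gronwall_eq_zero[where x = "\<lambda>s. D s - E s" and T = T and s = 0])
    fix s assume s: "s \<in> {0..T}"
    show "((\<lambda>s. D s - E s) has_vector_derivative transpose (At s) ** (D s - E s) + (D s - E s) ** At s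
        + trace (D s - E s) *\<^sub>R K s) (at s within {0..T})"
      using has_vector_derivative_diff[OF D[OF s] E'[OF s]] psd_cone_trace_nonneg[OF psd[OF s]]
      by (simp add: mm_simps trace_diff algebra_simps)
    show "norm (transpose (At s) ** (D s - E s) + (D s - E s) ** At s + trace (D s - E s) *\<^sub>R K s)
        \<le> c * norm (D s - E s)"
      by (rule c(2)[OF s]) simp
  qed (use T E0 in auto)
  then show ?thesis using psd[of T] T by simp
qed

section \<open>Observability and strict positivity\<close>

lemma matpow_commute: "A ** matpow A k = matpow A k ** A"
  by (induction k) (auto simp: matrix_mul_assoc)

lemma observable_imp_eq_zero:
  fixes A :: "real^'n^'n" and C :: "real^'n^'m"
  assumes "observable A C" and z: "\<And>k. C ** matpow A k *v x = 0"
  shows "x = 0"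
proof -
  have "(observability_matrix A C *v x) $ r = (C ** matpow A (to_nat_on UNIV (fst r)) *v x) $ snd r" for r
    by (simp add: observability_matrix_def matrix_vector_mult_def row_def)
  then have "observability_matrix A C *v x = 0"
    by (simp add: vec_eq_iff z)
  moreover have "inj ((*v) (observability_matrix A C))"
    using assms(1) by (simp add: observable_def full_rank_injective)
  ultimately show ?thesis
    by (metis injD mv.zero_right)
qed

text \<open>Differentiating \<open>C ** matpow A k *v w r = 0\<close> along the flow gives the same
  identity for \<open>k + 1\<close>, so every \<open>C ** matpow A k\<close> annihilates
  \<open>w 0\<close>.\<close>

lemma observable_linear_flow_eq_zero:
  fixes A :: "real^'n^'n" and C :: "real^'n^'m"
  assumes obs: "observable A C" and "T > 0" and "\<alpha> \<noteq> 0"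
    and w: "\<And>r. r \<in> {0..T} \<Longrightarrow> (w has_vector_derivative \<alpha> *\<^sub>R (A *v w r)) (at r within {0..T})"
    and Cw: "\<And>r. r \<in> {0..T} \<Longrightarrow> C *v w r = 0"
  shows "w 0 = 0"
proof -
  have "C ** matpow A k *v w r = 0" if "r \<in> {0..T}" for k r
    using that
  proof (induction k arbitrary: r)
    case (Suc k)
    have "((\<lambda>r. C ** matpow A k *v w r) has_vector_derivative C ** matpow A k *v (\<alpha> *\<^sub>R (A *v w r)))
        (at r within {0..T})"
      by (rule bounded_linear.has_vector_derivative[OF mv.bounded_linear_right w[OF Suc.prems]])
    then have "C ** matpow A k *v (\<alpha> *\<^sub>R (A *v w r)) = 0"
      by (rule has_vector_derivative_eq_zero[OF \<open>T > 0\<close> Suc.prems, rotated]) (rule Suc.IH)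
    then show ?case
      using \<open>\<alpha> \<noteq> 0\<close>
      by (simp add: mv.scaleR_right matrix_vector_mul_assoc matpow_commute flip: matrix_mul_assoc)
  qed (use Cw in simp)
  then show ?thesis
    using \<open>T > 0\<close> by (intro observable_imp_eq_zero[OF obs]) auto
qed

text \<open>\<open>ker\<close> isolates what is required of the coefficients: on kernel vectors of
  \<open>D s\<close> where the form \<open>K s\<close> vanishes too, the backward flow is that of
  \<open>\<alpha> A\<close> and unobserved by \<open>C\<close>.\<close>

lemma trace_forced_lyapunov_pos_def:
  fixes At D K :: "real \<Rightarrow> real^'n^'n" and A :: "real^'n^'n" and C :: "real^'n^'m"
  assumes T: "0 < T" and cA: "continuous_on {0..T} At" and cK: "continuous_on {0..T} K"
    and D: "\<And>s. s \<in> {0..T} \<Longrightarrow>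
      (D has_vector_derivative (transpose (At s) ** D s + D s ** At s + trace (D s) *\<^sub>R K s)) (at s within {0..T})"
    and K: "\<And>s. s \<in> {0..T} \<Longrightarrow> K s \<in> psd_cone"
    and D0: "D 0 \<in> psd_cone" "D 0 \<noteq> 0"
    and obs: "observable A C" "\<alpha> \<noteq> 0"
    and ker: "\<And>s u. s \<in> {0..T} \<Longrightarrow> D s *v u = 0 \<Longrightarrow> u \<bullet> (K s *v u) = 0 \<Longrightarrow>
      C *v u = 0 \<and> At s *v u = \<alpha> *\<^sub>R (A *v u)"
  shows "pos_def (D T)"
proof (rule pos_defI)
  have psd: "D t \<in> psd_cone" if t: "t \<in> {0..T}" for t
    by (rule trace_forced_lyapunov_psd[where At = At and K = K])
      (use t D0 in \<open>auto intro!: has_vector_derivative_within_subset[OF D] K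
        intro: continuous_on_subset[OF cA] continuous_on_subset[OF cK]\<close>)
  then show "D T \<in> psd_cone" using T by simp
  obtain c where c: "c > 0" "\<And>s Z a. s \<in> {0..T} \<Longrightarrow> \<bar>a\<bar> \<le> \<bar>trace Z\<bar> \<Longrightarrow>
      norm (transpose (At s) ** Z + Z ** At s + a *\<^sub>R K s) \<le> c * norm Z"
    using lyapunov_operator_bound[OF cA cK] by blast
  have nz: "D t \<noteq> 0" if t: "t \<in> {0..T}" for t
  proof
    assume "D t = 0"
    have "D 0 = 0"
      by (rule gronwall_eq_zero[where x = D and K = c, OF D c(2) _ t \<open>D t = 0\<close>]) (use T in auto)
    then show False using D0 by simp
  qed
  fix v assume v: "D T *v v = 0"
  obtain w where w0: "w 0 = v"
    and w: "\<And>r. r \<in> {0..T} \<Longrightarrow> (w has_vector_derivative At (T - r) *v w r) (at r within {0..T})"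
    and h: "\<And>r. r \<in> {0..T} \<Longrightarrow> ((\<lambda>r. w r \<bullet> (D (T - r) *v w r)) has_vector_derivative
        - (w r \<bullet> ((trace (D (T - r)) *\<^sub>R K (T - r)) *v w r))) (at r within {0..T})"
    using lyapunov_backward_flow[OF less_imp_le[OF T] cA D] by blast
  \<comment> \<open>The form is 0 at \<open>r = 0\<close>, never increases in \<open>r\<close> and
    is nonnegative, so it vanishes throughout.\<close>
  have h0: "w r \<bullet> (D (T - r) *v w r) = 0" if r: "r \<in> {0..T}" for r
  proof -
    have "- (w 0 \<bullet> (D (T - 0) *v w 0)) \<le> - (w r \<bullet> (D (T - r) *v w r))"
    proof (rule has_real_derivative_nonneg_imp_le[where g = "\<lambda>r. - (w r \<bullet> (D (T - r) *v w r))"])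
      fix s assume s: "0 \<le> s" "s \<le> r"
      show "((\<lambda>r. - (w r \<bullet> (D (T - r) *v w r))) has_real_derivative
          - (- (w s \<bullet> ((trace (D (T - s)) *\<^sub>R K (T - s)) *v w s)))) (at s within {0..r})"
        unfolding has_real_derivative_iff_has_vector_derivative
        by (rule has_vector_derivative_within_subset[OF has_vector_derivative_minus[OF h]]) (use s r in auto)
      show "0 \<le> - (- (w s \<bullet> ((trace (D (T - s)) *\<^sub>R K (T - s)) *v w s)))"
        using psd_cone_nonneg[OF psd_cone_scaleR[OF K psd_cone_trace_nonneg[OF psd]], of "T - s" "T - s"] s r
        by simp
    qed (use r in auto)
    then show ?thesis
      using psd_cone_nonneg[OF psd, of "T - r" "w r"] r v w0 by simp
  qed
  have "C *v w r = 0 \<and> At (T - r) *v w r = \<alpha> *\<^sub>R (A *v w r)" if r: "r \<in> {0..T}" for r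
  proof (rule ker)
    show "T - r \<in> {0..T}" using r by auto
    then show "D (T - r) *v w r = 0"
      by (intro psd_cone_kernel psd h0 r)
    \<comment> \<open>The derivative of an identically zero form is zero; the positive trace is then
      divided out.\<close>
    have "- (w r \<bullet> ((trace (D (T - r)) *\<^sub>R K (T - r)) *v w r)) = 0"
      by (rule has_vector_derivative_eq_zero[OF T r h0 h[OF r]])
    moreover have "trace (D (T - r)) > 0"
      using r by (intro psd_cone_trace_pos psd nz) auto
    ultimately show "w r \<bullet> (K (T - r) *v w r) = 0"
      by (simp add: mv.scaleR_left)
  qed
  then have "w 0 = 0"
    using w by (intro observable_linear_flow_eq_zero[OF obs(1) T obs(2), of w]) auto
  then show "v = 0" using w0 by simp
qed

subsection \<open>The trace-scaled Riccati flow\<close>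

text \<open>Division by a Lipschitz \<open>N\<close> that dominates the norm reduces quadratic
  growth to linear growth and makes the map globally Lipschitz.\<close>

lemma homogeneous_quadratic_lipschitz:
  fixes b :: "'a::real_normed_vector \<Rightarrow> 'a \<Rightarrow> 'b::real_normed_vector"
  assumes b: "bounded_bilinear b"
    and N: "\<And>x. norm x \<le> N x" and L: "L \<ge> 0" "\<And>x y. \<bar>N x - N y\<bar> \<le> L * norm (x - y)"
  obtains K where "K > 0"
    "\<And>x y. norm ((1 / N x) *\<^sub>R b x x - (1 / N y) *\<^sub>R b y y) \<le> K * norm (x - y)"
proof -
  interpret b: bounded_bilinear b by (rule b)
  obtain k where k: "k > 0" "\<And>x y. norm (b x y) \<le> norm x * norm y * k"
    using b.pos_bounded by blast
  have frac: "norm x / N x \<le> 1" for x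
    using N[of x] order_trans[OF norm_ge_zero N[of x]] by (cases "N x = 0") (auto simp: divide_le_eq_1)
  have N0: "N x \<ge> 0" for x
    using N[of x] norm_ge_zero[of x] by linarith
  have b1: "norm ((1 / N x) *\<^sub>R b x y) \<le> k * norm y" "norm ((1 / N x) *\<^sub>R b y x) \<le> k * norm y" for x y
  proof -
    have "norm ((1 / N x) *\<^sub>R b x y) \<le> (norm x * norm y * k) / N x"
      using divide_right_mono[OF k(2)[of x y] N0[of x]] N0[of x] by simp
    moreover have "norm ((1 / N x) *\<^sub>R b y x) \<le> (norm y * norm x * k) / N x"
      using divide_right_mono[OF k(2)[of y x] N0[of x]] N0[of x] by simp
    moreover have "(norm x / N x) * (norm y * k) \<le> 1 * (norm y * k)"
      using k(1) by (intro mult_right_mono frac) auto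
    ultimately show "norm ((1 / N x) *\<^sub>R b x y) \<le> k * norm y" "norm ((1 / N x) *\<^sub>R b y x) \<le> k * norm y"
      by (simp_all add: mult_ac)
  qed
  show thesis
  proof
    show "k * (2 + L) > 0" using k L by simp
    fix x y
    show "norm ((1 / N x) *\<^sub>R b x x - (1 / N y) *\<^sub>R b y y) \<le> k * (2 + L) * norm (x - y)"
    proof (cases "x = 0 \<or> y = 0")
      case True
      have "k * norm z \<le> k * (2 + L) * norm z" for z :: 'a
        using k L by (intro mult_right_mono) auto
      then show ?thesis
        using True b1(1)[of x x] b1(1)[of y y] order_trans by (fastforce simp: b.zero_left)
    next
      case False
      then have pos: "N x > 0" "N y > 0"
        using N[of x] N[of y] by (metis order_less_le_trans zero_less_norm_iff)+
      \<comment> \<open>One factor changes at a time; the last term combines the Lipschitz bound for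
        \<open>N\<close> with \<open>norm y / N y \<le> 1\<close>.\<close>
      have eq: "(1 / N x) *\<^sub>R b x x - (1 / N y) *\<^sub>R b y y
          = (1 / N x) *\<^sub>R b x (x - y) + (1 / N y) *\<^sub>R b (x - y) y + (1 / N x - 1 / N y) *\<^sub>R b x y"
        by (simp add: b.diff_left b.diff_right algebra_simps)
      have "norm ((1 / N x - 1 / N y) *\<^sub>R b x y) = \<bar>N x - N y\<bar> / N y * norm ((1 / N x) *\<^sub>R b x y)"
        using pos by (simp add: field_simps abs_mult abs_minus_commute)
      also have "\<dots> \<le> (L * norm (x - y)) / N y * (k * norm y)"
        using pos L by (intro mult_mono divide_right_mono b1) auto
      also have "\<dots> = (k * L * norm (x - y)) * (norm y / N y)" by simp
      also have "\<dots> \<le> (k * L * norm (x - y)) * 1"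
        using k L by (intro mult_left_mono frac) auto
      finally have "norm ((1 / N x - 1 / N y) *\<^sub>R b x y) \<le> k * L * norm (x - y)" by simp
      then show ?thesis
        unfolding eq using b1(1)[of x "x - y"] b1(2)[of y "x - y"]
        by (intro order_trans[OF norm_triangle_ineq] order_trans[OF add_mono[OF norm_triangle_ineq order_refl]])
          (simp add: algebra_simps)
    qed
  qed
qed

text \<open>\<open>S\<close> abstracts \<open>B ** matrix_inv R ** transpose B\<close>; \<alpha> is
  any positive number until the final theorem fixes it.\<close>

locale trace_riccati =
  fixes A S :: "real^'n^'n" and C :: "real^'n^'m" and \<alpha> :: real
  assumes S: "S \<in> psd_cone" and obs: "observable A C" and \<alpha>: "\<alpha> > 0"
begin

definition ric :: "real^'n^'n \<Rightarrow> real^'n^'n" where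
  "ric X = \<alpha> *\<^sub>R (transpose A ** X) + \<alpha> *\<^sub>R (X ** A) - (1 / trace X) *\<^sub>R (X ** S ** X)
     + (\<alpha>\<^sup>2 * trace X) *\<^sub>R (transpose C ** C)"

text \<open>Staying in the cone and away from zero is part of the notion, so that the linear theory
  applies at once; \<open>ric_solutionI\<close> recovers it from the equation, nonzero trace and an
  initial value in the cone.\<close>

definition ric_solution :: "(real \<Rightarrow> real^'n^'n) \<Rightarrow> bool" where
  "ric_solution P \<longleftrightarrow>
     (\<forall>t\<ge>0. P t \<in> psd_cone \<and> P t \<noteq> 0 \<and> (P has_vector_derivative ric (P t)) (at t within {0..}))"

lemma S_sym: "transpose S = S"
  by (rule psd_cone_transpose[OF S])

lemma ric_solutionD:
  assumes "ric_solution P" "t \<ge> 0"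
  shows "P t \<in> psd_cone" "P t \<noteq> 0" "trace (P t) > 0" "transpose (P t) = P t"
    "(P has_vector_derivative ric (P t)) (at t within {0..})"
  using assms by (auto simp: ric_solution_def psd_cone_trace_pos psd_cone_transpose)

lemma ric_solution_continuous:
  assumes "ric_solution P" shows "continuous_on {0..T} P"
  by (rule continuous_on_vector_derivative[where f' = "\<lambda>t. ric (P t)"])
    (use assms in \<open>auto intro: has_vector_derivative_within_subset[OF ric_solutionD(5)]\<close>)

lemma ric_solution_shift:
  assumes "ric_solution P" "a \<ge> 0"
  shows "ric_solution (\<lambda>t. P (a + t))"
  unfolding ric_solution_def
proof (intro allI impI conjI)
  fix t :: real assume "t \<ge> 0"
  then have t: "a + t \<ge> 0" using assms by simp
  then show "P (a + t) \<in> psd_cone" "P (a + t) \<noteq> 0"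
    using ric_solutionD[OF assms(1)] by auto
  have "((\<lambda>t. a + t) has_vector_derivative 1) (at t within {0..})"
    by (auto intro!: derivative_eq_intros)
  moreover have "(P has_vector_derivative ric (P (a + t))) (at (a + t) within (\<lambda>t. a + t) ` {0..})"
    by (rule has_vector_derivative_within_subset[OF ric_solutionD(5)[OF assms(1) t]]) (use assms in auto)
  ultimately show "((\<lambda>t. P (a + t)) has_vector_derivative ric (P (a + t))) (at t within {0..})"
    using vector_diff_chain_within[of "\<lambda>t. a + t" 1 t "{0..}" P] by (simp add: o_def)
qed

text \<open>Each product with \<open>At\<close> takes half of the quadratic term, hence the factor
  2.\<close>

lemma ric_eq_lyapunov:
  assumes "transpose X = X" "trace X \<noteq> 0"
  defines "At \<equiv> \<alpha> *\<^sub>R A - (1 / (2 * trace X)) *\<^sub>R (S ** X)"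
  shows "ric X = transpose At ** X + X ** At + trace X *\<^sub>R (\<alpha>\<^sup>2 *\<^sub>R (transpose C ** C))"
proof -
  have "ric X - (transpose At ** X + X ** At + trace X *\<^sub>R (\<alpha>\<^sup>2 *\<^sub>R (transpose C ** C))) = 0"
    unfolding At_def ric_def
    by (simp only: mm_simps tp_simps S_sym assms(1))
      (use assms(2) in \<open>simp add: vec_eq_iff field_simps\<close>)
  then show ?thesis by simp
qed

text \<open>\<open>X S X - P S P\<close> is half the sum of \<open>(X - P) S (X + P)\<close> and
  \<open>(X + P) S (X - P)\<close>. The change of \<open>1 / trace\<close> contributes
  \<open>trace (X - P)\<close> times the first summand of \<open>K\<close>.\<close>

lemma ric_diff_eq_lyapunov:
  assumes "transpose X = X" "transpose P = P" "trace X \<noteq> 0" "trace P \<noteq> 0"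
  defines "At \<equiv> \<alpha> *\<^sub>R A - (1 / (2 * trace X)) *\<^sub>R (S ** (X + P))"
    and "K \<equiv> (1 / (trace P * trace X)) *\<^sub>R (P ** S ** P) + \<alpha>\<^sup>2 *\<^sub>R (transpose C ** C)"
  shows "ric X - ric P = transpose At ** (X - P) + (X - P) ** At + trace (X - P) *\<^sub>R K"
proof -
  have "(ric X - ric P) - (transpose At ** (X - P) + (X - P) ** At + trace (X - P) *\<^sub>R K) = 0"
    unfolding At_def K_def ric_def
    by (simp only: mm_simps tp_simps S_sym assms(1,2) trace_diff)
      (use assms(3,4) in \<open>simp add: vec_eq_iff field_simps power2_eq_square\<close>)
  then show ?thesis by simp
qed

lemma ric_solution_pos_def:
  assumes P: "ric_solution P" and "T > 0"
  shows "pos_def (P T)"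
proof (rule trace_forced_lyapunov_pos_def[where \<alpha> = \<alpha> and A = A and C = C])
  let ?At = "\<lambda>s. \<alpha> *\<^sub>R A - (1 / (2 * trace (P s))) *\<^sub>R (S ** P s)"
  let ?K = "\<lambda>s::real. \<alpha>\<^sup>2 *\<^sub>R (transpose C ** C)"
  note PD = ric_solutionD[OF P]
  show "continuous_on {0..T} ?At"
    by (intro continuous_intros ric_solution_continuous[OF P]) (use PD(3) in force)
  show "continuous_on {0..T} ?K" by (intro continuous_intros)
  show "(P has_vector_derivative transpose (?At s) ** P s + P s ** ?At s + trace (P s) *\<^sub>R ?K s)
      (at s within {0..T})" if "s \<in> {0..T}" for s
    using that PD(3,4)[of s]
    by (subst ric_eq_lyapunov[symmetric]) (auto intro!: has_vector_derivative_within_subset[OF PD(5)])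
  show "?K s \<in> psd_cone" for s
    by (intro psd_cone_scaleR psd_cone_gram) simp
  show "P 0 \<in> psd_cone" "P 0 \<noteq> 0" using PD by auto
  fix s u assume "P s *v u = 0" "u \<bullet> (?K s *v u) = 0"
  then show "C *v u = 0 \<and> ?At s *v u = \<alpha> *\<^sub>R (A *v u)"
    using \<alpha> inner_transpose[of u C "C *v u"]
    by (simp add: mv.scaleR_left mv.diff_left del: transpose_matrix_vector flip: matrix_vector_mul_assoc)
qed (use assms obs \<alpha> in auto)

lemma ric_solution_comparison:
  assumes X: "ric_solution X" and P: "ric_solution P" and "T \<ge> 0" and le: "X 0 - P 0 \<in> psd_cone"
  shows "X T - P T \<in> psd_cone"
    and "T > 0 \<Longrightarrow> X 0 \<noteq> P 0 \<Longrightarrow> pos_def (X T - P T)"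
proof -
  define At where "At s = \<alpha> *\<^sub>R A - (1 / (2 * trace (X s))) *\<^sub>R (S ** (X s + P s))" for s
  define K where "K s = (1 / (trace (P s) * trace (X s))) *\<^sub>R (P s ** S ** P s) + \<alpha>\<^sup>2 *\<^sub>R (transpose C ** C)" for s
  note XD = ric_solutionD[OF X] and PD = ric_solutionD[OF P]
  have cA: "continuous_on {0..T} At"
    unfolding At_def
    by (intro continuous_intros ric_solution_continuous[OF X] ric_solution_continuous[OF P]) (use XD(3) in force)
  have cK: "continuous_on {0..T} K"
    unfolding K_def
    by (intro continuous_intros ric_solution_continuous[OF X] ric_solution_continuous[OF P])
      (use XD(3) PD(3) in force)
  have D: "((\<lambda>s. X s - P s) has_vector_derivative
      transpose (At s) ** (X s - P s) + (X s - P s) ** At s + trace (X s - P s) *\<^sub>R K s) (at s within {0..T})"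
    if "s \<in> {0..T}" for s
    using that XD(3,4)[of s] PD(3,4)[of s] unfolding At_def K_def
    by (subst ric_diff_eq_lyapunov[symmetric])
      (auto intro!: has_vector_derivative_diff has_vector_derivative_within_subset[OF XD(5)]
        has_vector_derivative_within_subset[OF PD(5)])
  have KP: "K s \<in> psd_cone" if "s \<in> {0..T}" for s
    unfolding K_def
    by (intro psd_cone_add psd_cone_scaleR psd_cone_gram psd_cone_sandwich S)
      (use that XD(1,3)[of s] PD(1,3)[of s] in auto)
  show "X T - P T \<in> psd_cone"
    by (rule trace_forced_lyapunov_psd[OF \<open>T \<ge> 0\<close> cA cK D KP le])
  assume "T > 0" and ne: "X 0 \<noteq> P 0"
  show "pos_def (X T - P T)"
  proof (rule trace_forced_lyapunov_pos_def[OF \<open>T > 0\<close> cA cK D KP le _ obs])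
    fix s u assume s: "s \<in> {0..T}" and ker: "(X s - P s) *v u = 0" "u \<bullet> (K s *v u) = 0"
    let ?c = "1 / (trace (P s) * trace (X s))"
    have c: "?c > 0" using s XD(3)[of s] PD(3)[of s] by simp
    have q: "u \<bullet> (K s *v u) = ?c * (u \<bullet> (P s ** S ** P s *v u)) + \<alpha>\<^sup>2 * (u \<bullet> (transpose C ** C *v u))"
      by (simp add: K_def mv.add_left mv.scaleR_left inner_add_right)
    have nn: "0 \<le> u \<bullet> (P s ** S ** P s *v u)" "0 \<le> u \<bullet> (transpose C ** C *v u)"
      using psd_cone_nonneg[OF psd_cone_sandwich[OF S PD(1)]] psd_cone_nonneg[OF psd_cone_gram] s by auto
    then have z: "u \<bullet> (P s ** S ** P s *v u) = 0" "u \<bullet> (transpose C ** C *v u) = 0"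
      using ker(2) c \<alpha> unfolding q by (auto simp: add_nonneg_eq_0_iff)
    have "(P s *v u) \<bullet> (S *v (P s *v u)) = 0"
      using z(1) psd_cone_inner_commute[OF PD(1), of s u "S *v (P s *v u)"] s
      by (simp flip: matrix_vector_mul_assoc)
    then have "S *v (P s *v u) = 0" by (rule psd_cone_kernel[OF S])
    \<comment> \<open>Both matrices agree on \<open>u\<close>, so \<open>S\<close> annihilates
      \<open>(X s + P s) *v u\<close> and the quadratic part of \<open>At\<close>
      disappears.\<close>
    moreover have "X s *v u = P s *v u" using ker(1) by (simp add: mv.diff_left)
    ultimately have "S *v ((X s + P s) *v u) = 0"
      by (simp only: mv.add_left mv.add_right add_0_right)
    then have "At s *v u = \<alpha> *\<^sub>R (A *v u)"
      by (simp add: At_def mv.diff_left mv.scaleR_left flip: matrix_vector_mul_assoc)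
    moreover have "C *v u = 0"
      using z(2) inner_transpose[of u C "C *v u"]
      by (simp del: transpose_matrix_vector flip: matrix_vector_mul_assoc)
    ultimately show "C *v u = 0 \<and> At s *v u = \<alpha> *\<^sub>R (A *v u)" by simp
  qed (use ne \<alpha> in auto)
qed

text \<open>A globally Lipschitz extension of \<^const>\<open>ric\<close> to all matrices: on the cone
  the trace dominates the norm, so there the maximum is the trace.\<close>

definition ric_ext :: "real^'n^'n \<Rightarrow> real^'n^'n" where
  "ric_ext X = \<alpha> *\<^sub>R (transpose A ** X) + \<alpha> *\<^sub>R (X ** A)
     - (1 / max (trace X) (norm X)) *\<^sub>R ((1/2) *\<^sub>R (transpose X ** S ** X + X ** S ** X))
     + (\<alpha>\<^sup>2 * \<bar>trace X\<bar>) *\<^sub>R (transpose C ** C)"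

lemma ric_ext_eq_ric: "X \<in> psd_cone \<Longrightarrow> ric_ext X = ric X"
  using psd_cone_norm_le_trace[of X] psd_cone_transpose[of X] psd_cone_trace_nonneg[of X]
  by (simp add: ric_ext_def ric_def max_def flip: scaleR_2)

lemma ric_ext_zero: "ric_ext 0 = 0"
  by (simp add: ric_ext_def mm_simps trace_zero)

text \<open>\<open>ric_ext\<close> averages \<open>transpose X ** S ** X\<close> and
  \<open>X ** S ** X\<close> so that this holds without symmetry of \<open>X\<close>; the absolute
  trace keeps the forcing positive semidefinite.\<close>

lemma ric_ext_eq_lyapunov:
  defines "At X \<equiv> \<alpha> *\<^sub>R A - (1 / (2 * max (trace X) (norm X))) *\<^sub>R (S ** X)"
  shows "ric_ext X = transpose (At X) ** X + X ** At X + (\<alpha>\<^sup>2 * \<bar>trace X\<bar>) *\<^sub>R (transpose C ** C)"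
  by (simp add: At_def ric_ext_def mm_simps tp_simps S_sym algebra_simps)

lemma ric_ext_lipschitz:
  obtains K where "K > 0" "\<And>X Y. norm (ric_ext X - ric_ext Y) \<le> K * norm (X - Y)"
proof -
  obtain m where m: "m > 0" "\<And>(X :: real^'n^'n) (Y :: real^'n^'n). norm (X ** Y) \<le> norm X * norm Y * m"
    using mm.pos_bounded by blast
  obtain d where d: "d > 0" "\<And>Z :: real^'n^'n. \<bar>trace Z\<bar> \<le> norm Z * d"
    using bounded_linear.pos_bounded[OF bounded_linear_trace] by auto
  define N where "N X = max (trace X) (norm X)" for X :: "real^'n^'n"
  have bb: "bounded_bilinear (\<lambda>X Y. (1/2) *\<^sub>R (transpose X ** S ** Y + X ** S ** Y))"
    by (rule bilinear_conv_bounded_bilinear[THEN iffD1])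
      (auto simp: bilinear_def mm_simps tp_simps algebra_simps intro!: linearI)
  have NL: "\<bar>N X - N Y\<bar> \<le> (d + 1) * norm (X - Y)" for X Y
  proof -
    have "\<bar>trace X - trace Y\<bar> \<le> d * norm (X - Y)"
      using d(2)[of "X - Y"] by (simp add: trace_diff mult.commute)
    moreover have "\<bar>norm X - norm Y\<bar> \<le> norm (X - Y)" by (rule norm_triangle_ineq3)
    moreover have "0 \<le> d * norm (X - Y)" using d by simp
    ultimately show ?thesis unfolding N_def max_def by (simp add: distrib_right) linarith
  qed
  obtain k where k: "k > 0"
    "\<And>X Y. norm ((1 / N X) *\<^sub>R ((1/2) *\<^sub>R (transpose X ** S ** X + X ** S ** X))
      - (1 / N Y) *\<^sub>R ((1/2) *\<^sub>R (transpose Y ** S ** Y + Y ** S ** Y))) \<le> k * norm (X - Y)"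
    by (rule homogeneous_quadratic_lipschitz[OF bb _ _ NL]) (use d in \<open>auto simp: N_def\<close>)
  let ?c = "\<alpha> * norm A * m + \<alpha> * norm A * m + k + \<alpha>\<^sup>2 * d * norm (transpose C ** C)"
  show thesis
  proof
    show "?c > 0" using \<alpha> m k d by (intro add_nonneg_pos add_pos_nonneg) auto
    fix X Y :: "real^'n^'n"
    let ?q = "\<lambda>X. (1 / N X) *\<^sub>R ((1/2) *\<^sub>R (transpose X ** S ** X + X ** S ** X))"
    have "ric_ext X - ric_ext Y = \<alpha> *\<^sub>R (transpose A ** (X - Y)) + \<alpha> *\<^sub>R ((X - Y) ** A) - (?q X - ?q Y)
        + (\<alpha>\<^sup>2 * (\<bar>trace X\<bar> - \<bar>trace Y\<bar>)) *\<^sub>R (transpose C ** C)"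
      by (simp add: ric_ext_def mm.diff_left mm.diff_right algebra_simps flip: N_def)
    also have "norm \<dots> \<le> norm (\<alpha> *\<^sub>R (transpose A ** (X - Y))) + norm (\<alpha> *\<^sub>R ((X - Y) ** A)) + norm (?q X - ?q Y)
        + norm ((\<alpha>\<^sup>2 * (\<bar>trace X\<bar> - \<bar>trace Y\<bar>)) *\<^sub>R (transpose C ** C))"
      by (intro norm_triangle_le norm_triangle_le_diff add_mono order_refl)
    also have "\<dots> \<le> \<alpha> * (norm A * norm (X - Y) * m) + \<alpha> * (norm (X - Y) * norm A * m) + k * norm (X - Y)
        + \<alpha>\<^sup>2 * (norm (X - Y) * d) * norm (transpose C ** C)"
    proof (intro add_mono k)
      show "norm (\<alpha> *\<^sub>R (transpose A ** (X - Y))) \<le> \<alpha> * (norm A * norm (X - Y) * m)"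
        using m(2)[of "transpose A" "X - Y"] \<alpha> by (simp add: norm_transpose)
      show "norm (\<alpha> *\<^sub>R ((X - Y) ** A)) \<le> \<alpha> * (norm (X - Y) * norm A * m)"
        using m(2)[of "X - Y" A] \<alpha> by simp
      have "\<bar>\<bar>trace X\<bar> - \<bar>trace Y\<bar>\<bar> \<le> norm (X - Y) * d"
        using d(2)[of "X - Y"] abs_triangle_ineq3[of "trace X" "trace Y"] by (simp add: trace_diff)
      then show "norm ((\<alpha>\<^sup>2 * (\<bar>trace X\<bar> - \<bar>trace Y\<bar>)) *\<^sub>R (transpose C ** C))
          \<le> \<alpha>\<^sup>2 * (norm (X - Y) * d) * norm (transpose C ** C)"
        by (simp add: abs_mult mult_left_mono mult_right_mono)
    qed
    also have "\<dots> = ?c * norm (X - Y)" by (simp add: algebra_simps)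
    finally show "norm (ric_ext X - ric_ext Y) \<le> ?c * norm (X - Y)" .
  qed
qed

text \<open>The Lipschitz extension has a global solution. It stays in the cone by its Lyapunov form
  and is never zero by the backward Gronwall estimate, so it solves the original equation.\<close>

lemma ric_solution_exists:
  assumes P0: "P0 \<in> psd_cone" "P0 \<noteq> 0"
  obtains P where "ric_solution P" "P 0 = P0"
proof -
  obtain K where K: "K > 0" "\<And>X Y. norm (ric_ext X - ric_ext Y) \<le> K * norm (X - Y)"
    using ric_ext_lipschitz by blast
  have "K-lipschitz_on UNIV ric_ext"
    using K by (auto simp: lipschitz_on_def dist_norm)
  then have cont: "continuous_on UNIV ric_ext" by (rule lipschitz_on_continuous_on)
  have "\<exists>P. P 0 = P0 \<and> (\<forall>t\<ge>0. (P has_vector_derivative ric_ext (P t)) (at t within {0..}))"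
    by (rule ode_global_existence[OF K(1)])
      (auto simp: ric_ext_zero intro: K continuous_on_compose2[OF cont])
  then obtain P where P: "P 0 = P0"
    "\<And>t. 0 \<le> t \<Longrightarrow> (P has_vector_derivative ric_ext (P t)) (at t within {0..})" by blast
  have P': "(P has_vector_derivative ric_ext (P s)) (at s within {0..T})" if "s \<in> {0..T}" for s T
    by (rule has_vector_derivative_within_subset[OF P(2)]) (use that in auto)
  have nz: "P t \<noteq> 0" if "t \<ge> 0" for t
  proof
    assume z: "P t = 0"
    have "P 0 = 0"
      by (rule gronwall_eq_zero[where x = P and s = t and T = t and K = K, OF P'])
        (use that z K(2)[of _ 0] in \<open>auto simp: ric_ext_zero\<close>)
    then show False using P P0 by simp
  qed
  have cP: "continuous_on {0..T} P" for T
    by (rule continuous_on_vector_derivative[OF P'])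
  have psd: "P t \<in> psd_cone" if "t \<ge> 0" for t
  proof (rule lyapunov_psd[OF that])
    let ?At = "\<lambda>s. \<alpha> *\<^sub>R A - (1 / (2 * max (trace (P s)) (norm (P s)))) *\<^sub>R (S ** P s)"
    have ne: "max (trace (P s)) (norm (P s)) \<noteq> 0" if "s \<in> {0..t}" for s
      using nz[of s] that by (metis atLeastAtMost_iff max.strict_coboundedI2 order_less_irrefl zero_less_norm_iff)
    show "continuous_on {0..t} ?At"
      by (intro continuous_intros cP) (use ne in auto)
    show "(P has_vector_derivative transpose (?At s) ** P s + P s ** ?At s
        + (\<alpha>\<^sup>2 * \<bar>trace (P s)\<bar>) *\<^sub>R (transpose C ** C)) (at s within {0..t})" if "s \<in> {0..t}" for s
      using P'[OF that] unfolding ric_ext_eq_lyapunov .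
  qed (use P P0 in \<open>auto intro!: psd_cone_scaleR psd_cone_gram\<close>)
  have "ric_solution P"
    unfolding ric_solution_def using psd nz P(2) by (metis ric_ext_eq_ric)
  then show thesis using that P by blast
qed

text \<open>The Lipschitz constant of \<open>ric_ext\<close> provides one \<open>K\<close> for all
  pairs of solutions.\<close>

lemma ric_solution_lipschitz_dependence:
  obtains K where
    "\<And>X P t. ric_solution X \<Longrightarrow> ric_solution P \<Longrightarrow> t \<ge> 0 \<Longrightarrow>
      norm (X t - P t) \<le> exp (K * t) * norm (X 0 - P 0)"
proof -
  obtain K where K: "K > 0" "\<And>X Y. norm (ric_ext X - ric_ext Y) \<le> K * norm (X - Y)"
    using ric_ext_lipschitz by blast
  show thesis
  proof (rule that)
    fix X P and t :: real assume X: "ric_solution X" and P: "ric_solution P" and t: "t \<ge> 0"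
    show "norm (X t - P t) \<le> exp (K * t) * norm (X 0 - P 0)"
    proof (rule gronwall_two_sided(1)[OF t, where x = "\<lambda>s. X s - P s"])
      fix s assume s: "0 \<le> s" "s \<le> t"
      show "((\<lambda>s. X s - P s) has_vector_derivative ric (X s) - ric (P s)) (at s within {0..t})"
        using s by (auto intro!: has_vector_derivative_diff
            has_vector_derivative_within_subset[OF ric_solutionD(5)[OF X]]
            has_vector_derivative_within_subset[OF ric_solutionD(5)[OF P]])
      show "norm (ric (X s) - ric (P s)) \<le> K * norm (X s - P s)"
        using K(2)[of "X s" "P s"] ric_solutionD(1)[OF X s(1)] ric_solutionD(1)[OF P s(1)]
        by (simp add: ric_ext_eq_ric)
    qed
  qed
qed

text \<open>Positive trace and symmetry come first, because the Lyapunov form of \<open>ric\<close>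
  presupposes symmetry and its forcing has the sign of the trace.\<close>

lemma ric_solutionI:
  assumes P: "\<And>t. t \<ge> 0 \<Longrightarrow> trace (P t) \<noteq> 0 \<and> (P has_vector_derivative ric (P t)) (at t within {0..})"
    and P0: "P 0 \<in> psd_cone"
  shows "ric_solution P"
proof -
  have P': "(P has_vector_derivative ric (P s)) (at s within {0..T})" if "s \<in> {0..T}" for s T
    by (rule has_vector_derivative_within_subset) (use that P in auto)
  have cP: "continuous_on {0..T} P" for T
    by (rule continuous_on_vector_derivative[OF P'])
  have tr0: "trace (P 0) > 0"
    using psd_cone_trace_nonneg[OF P0] P[of 0] by simp
  have trpos: "trace (P t) > 0" if "t \<ge> 0" for t
  proof (rule ccontr)
    assume "\<not> trace (P t) > 0"
    moreover have "continuous_on {0..t} (\<lambda>s. trace (P s))"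
      by (intro continuous_intros cP)
    ultimately have "\<exists>s\<ge>0. s \<le> t \<and> trace (P s) = 0"
      using tr0 that by (intro IVT2') auto
    then show False using P by blast
  qed
  have sym: "transpose (P t) = P t" if "t \<ge> 0" for t
  proof -
    \<comment> \<open>The factor 2 is absent here: for the antisymmetric part, the terms
      \<open>transpose P S P\<close> cancel between the two products.\<close>
    let ?At = "\<lambda>s. \<alpha> *\<^sub>R A - (1 / trace (P s)) *\<^sub>R (S ** P s)"
    have "P t - transpose (P t) \<in> psd_cone"
    proof (rule lyapunov_psd[OF that, where D = "\<lambda>s. P s - transpose (P s)" and Q = "\<lambda>_. 0"])
      show "continuous_on {0..t} ?At"
        by (intro continuous_intros cP) (use P in auto)
      show "((\<lambda>s. P s - transpose (P s)) has_vector_derivative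
          transpose (?At s) ** (P s - transpose (P s)) + (P s - transpose (P s)) ** ?At s + 0)
          (at s within {0..t})" if s: "s \<in> {0..t}" for s
      proof -
        have "trace (transpose (P s)) = trace (P s)" by (simp add: trace_def transpose_def)
        then have "ric (P s) - transpose (ric (P s)) =
            transpose (?At s) ** (P s - transpose (P s)) + (P s - transpose (P s)) ** ?At s + 0"
          by (simp add: ric_def mm_simps tp_simps S_sym algebra_simps)
        then show ?thesis
          using has_vector_derivative_diff[OF P'[OF s]
            bounded_linear.has_vector_derivative[OF bounded_linear_transpose P'[OF s]]] by simp
      qed
    qed (use psd_cone_transpose[OF P0] psd_cone_0 in auto)
    \<comment> \<open>Cone membership is used for symmetry: a symmetric and antisymmetric matrix is
      zero.\<close>
    then have "transpose (P t - transpose (P t)) = P t - transpose (P t)"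
      by (rule psd_cone_transpose)
    then have "2 *\<^sub>R P t = 2 *\<^sub>R transpose (P t)"
      by (simp add: tp_simps scaleR_2 algebra_simps)
    then show ?thesis by simp
  qed
  have psd: "P t \<in> psd_cone" if "t \<ge> 0" for t
  proof (rule lyapunov_psd[OF that])
    let ?At = "\<lambda>s. \<alpha> *\<^sub>R A - (1 / (2 * trace (P s))) *\<^sub>R (S ** P s)"
    show "continuous_on {0..t} ?At"
      by (intro continuous_intros cP) (use P in auto)
    show "(P has_vector_derivative transpose (?At s) ** P s + P s ** ?At s
        + trace (P s) *\<^sub>R (\<alpha>\<^sup>2 *\<^sub>R (transpose C ** C))) (at s within {0..t})" if "s \<in> {0..t}" for s
      by (subst ric_eq_lyapunov[symmetric]) (use P' sym P that in auto)
    show "trace (P s) *\<^sub>R (\<alpha>\<^sup>2 *\<^sub>R (transpose C ** C)) \<in> psd_cone" if "s \<in> {0..t}" for s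
      using that trpos[of s] by (intro psd_cone_scaleR psd_cone_gram) auto
  qed (rule P0)
  show ?thesis
    unfolding ric_solution_def
    using psd P by (metis trace_zero)
qed

section \<open>Convergence to the ray of equilibria\<close>

lemma ric_solution_tendsto_ray:
  assumes Pe: "pos_def Pe" and eq: "\<And>c. c > 0 \<Longrightarrow> ric (c *\<^sub>R Pe) = 0"
    and P: "ric_solution P"
  obtains L where "L > 0" "(P \<longlongrightarrow> L *\<^sub>R Pe) at_top"
proof -
  note PD = ric_solutionD[OF P]
  have const: "ric_solution (\<lambda>_. c *\<^sub>R Pe)" if "c > 0" for c
    unfolding ric_solution_def
    using that pos_def_nonzero[OF Pe] psd_cone_scaleR[OF pos_def_imp_psd_cone[OF Pe], of c]
    by (simp add: eq)
  \<comment> \<open>Comparison with constant solutions after a time shift: a solution once below or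
    above a positive multiple of \<open>Pe\<close> stays there.\<close>
  have upper: "c *\<^sub>R Pe - P t' \<in> psd_cone" if "c > 0" "0 \<le> t" "t \<le> t'" "c *\<^sub>R Pe - P t \<in> psd_cone" for c t t'
    using ric_solution_comparison(1)[OF const[OF that(1)] ric_solution_shift[OF P that(2)], of "t' - t"] that
    by simp
  have lower: "P t' - c *\<^sub>R Pe \<in> psd_cone" if "c > 0" "0 \<le> t" "t \<le> t'" "P t - c *\<^sub>R Pe \<in> psd_cone" for c t t'
    using ric_solution_comparison(1)[OF ric_solution_shift[OF P that(2)] const[OF that(1)], of "t' - t"] that
    by simp
  define U where "U = {l. 0 < l \<and> (\<exists>t\<ge>0. l *\<^sub>R Pe - P t \<in> psd_cone)}"
  \<comment> \<open>By time 1 the solution is positive definite even if \<open>P 0\<close> is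
    singular; \<open>m\<close> then bounds it below for good and keeps \<open>L\<close>
    positive.\<close>
  obtain m where m: "m > 0" "P 1 - m *\<^sub>R Pe \<in> psd_cone"
    using pos_def_absorbs[OF ric_solution_pos_def[OF P zero_less_one] psd_cone_transpose[OF pos_def_imp_psd_cone[OF Pe]]] .
  have low: "P t - m *\<^sub>R Pe \<in> psd_cone" if "t \<ge> 1" for t
    by (rule lower[OF m(1) _ that m(2)]) simp
  have mU: "m \<le> l" if l: "l \<in> U" for l
  proof -
    obtain t where t: "l > 0" "t \<ge> 0" "l *\<^sub>R Pe - P t \<in> psd_cone" using l by (auto simp: U_def)
    have "l *\<^sub>R Pe - P (t + 1) + (P (t + 1) - m *\<^sub>R Pe) \<in> psd_cone"
      using t by (intro psd_cone_add low upper[of l t "t + 1"]) auto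
    then have "(l - m) *\<^sub>R Pe \<in> psd_cone" by (simp add: scaleR_diff_left)
    then show ?thesis using pos_def_scaleR_in_psd_cone_iff[OF Pe] by simp
  qed
  obtain l0 where l0: "l0 > 0" "l0 *\<^sub>R Pe - P 0 \<in> psd_cone"
    using pos_def_absorbs_scaled[OF Pe PD(1)[OF order_refl]] .
  have "l0 \<in> U" using l0 by (auto simp: U_def)
  then have Une: "U \<noteq> {}" by blast
  have Ubdd: "bdd_below U" using mU by (rule bdd_belowI)
  define L where "L = Inf U"
  have "m \<le> L" unfolding L_def by (rule cInf_greatest[OF Une mU])
  then have L0: "L > 0" using m by simp
  have LU: "\<exists>t0\<ge>0. \<forall>t\<ge>t0. l *\<^sub>R Pe - P t \<in> psd_cone" if Ll: "L < l" for l
  proof -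
    obtain l' where l': "l' \<in> U" "l' < l"
      using cInf_less_iff[OF Une Ubdd, of l] Ll unfolding L_def by auto
    then obtain t0 where t0: "l' > 0" "t0 \<ge> 0" "l' *\<^sub>R Pe - P t0 \<in> psd_cone" by (auto simp: U_def)
    have "(l - l') *\<^sub>R Pe + (l' *\<^sub>R Pe - P t) \<in> psd_cone" if "t \<ge> t0" for t
      by (rule psd_cone_add[OF _ upper[OF t0(1,2) that t0(3)]])
        (use l' in \<open>simp add: pos_def_scaleR_in_psd_cone_iff[OF Pe]\<close>)
    then have "l *\<^sub>R Pe - P t \<in> psd_cone" if "t \<ge> t0" for t
      using that by (simp add: scaleR_diff_left)
    then show ?thesis using t0(2) by blast
  qed
  have "(P \<longlongrightarrow> L *\<^sub>R Pe) at_top"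
  proof (rule ccontr)
    assume "\<not> (P \<longlongrightarrow> L *\<^sub>R Pe) at_top"
    then obtain e where e: "e > 0" "\<And>T. \<exists>t\<ge>T. dist (P t) (L *\<^sub>R Pe) \<ge> e"
      by (auto simp: tendsto_iff eventually_at_top_linorder not_less)
    \<comment> \<open>The shift by 1 puts every \<open>s k\<close> in the range where the lower
      bound \<open>m\<close> holds.\<close>
    then have "\<forall>k. \<exists>t. t \<ge> real k + 1 \<and> dist (P t) (L *\<^sub>R Pe) \<ge> e" by blast
    then obtain s where s: "\<And>k. s k \<ge> real k + 1" "\<And>k. dist (P (s k)) (L *\<^sub>R Pe) \<ge> e"
      by metis
    have "norm (P (s k)) \<le> l0 * trace Pe" for k
    proof -
      have sk: "s k \<ge> 0" using s(1)[of k] by linarith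
      have "norm (P (s k)) \<le> trace (P (s k))"
        by (intro psd_cone_norm_le_trace PD sk)
      also have "\<dots> \<le> l0 * trace Pe"
        using psd_cone_trace_nonneg[OF upper[OF l0(1) _ sk l0(2)]] by (simp add: trace_diff trace_scaleR)
      finally show ?thesis .
    qed
    then have "bounded (range (P \<circ> s))" by (auto simp: bounded_iff)
    from bounded_imp_convergent_subsequence[OF this]
    obtain Pb r where r: "strict_mono r" and lim: "(P \<circ> s \<circ> r) \<longlonglongrightarrow> Pb"
      by auto
    have sr: "s (r k) \<ge> real k + 1" for k
      using s(1)[of "r k"] seq_suble[OF r, of k] by (meson add_right_mono of_nat_le_iff order_trans)
    have sr0: "s (r k) \<ge> 0" for k
      using sr[of k] by linarith
    have "e \<le> dist Pb (L *\<^sub>R Pe)"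
      by (rule tendsto_lowerbound[OF tendsto_dist[OF lim tendsto_const]]) (auto simp: s)
    then have ne: "L *\<^sub>R Pe \<noteq> Pb" using e by auto
    have "Pb \<in> psd_cone"
      by (rule closed_sequentially[OF closed_psd_cone _ lim]) (simp add: PD(1) sr0)
    have "Pb - m *\<^sub>R Pe \<in> psd_cone"
      by (rule closed_sequentially[OF closed_psd_cone _ tendsto_diff[OF lim tendsto_const]])
        (auto intro!: low order_trans[OF _ sr])
    then have "Pb \<noteq> 0"
      using pos_def_scaleR_in_psd_cone_iff[OF Pe, of "- m"] m by auto
    have up: "l *\<^sub>R Pe - Pb \<in> psd_cone" if Ll: "L < l" for l
    proof -
      obtain t0 where t0: "\<And>t. t \<ge> t0 \<Longrightarrow> l *\<^sub>R Pe - P t \<in> psd_cone" using LU[OF Ll] by auto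
      obtain k0 :: nat where k0: "real k0 \<ge> t0" using real_arch_simple by blast
      have "(\<lambda>k. l *\<^sub>R Pe - (P \<circ> s \<circ> r) k) \<longlonglongrightarrow> l *\<^sub>R Pe - Pb"
        by (intro tendsto_intros lim)
      moreover have "\<forall>\<^sub>F k in sequentially. l *\<^sub>R Pe - (P \<circ> s \<circ> r) k \<in> psd_cone"
        unfolding eventually_sequentially
      proof (intro exI allI impI)
        fix k assume "k0 \<le> k"
        then have "real k0 \<le> real k" by simp
        then have "s (r k) \<ge> t0" using sr[of k] k0 by linarith
        then show "l *\<^sub>R Pe - (P \<circ> s \<circ> r) k \<in> psd_cone" using t0 by simp
      qed
      ultimately show ?thesis
        by (rule Lim_in_closed_set[OF closed_psd_cone _ sequentially_bot, rotated])
    qed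
    \<comment> \<open>The bounds with \<open>l > L\<close> pass to \<open>L\<close> because the cone
      is closed.\<close>
    have le: "L *\<^sub>R Pe - Pb \<in> psd_cone"
    proof (rule Lim_in_closed_set[OF closed_psd_cone])
      show "((\<lambda>l. l *\<^sub>R Pe - Pb) \<longlongrightarrow> L *\<^sub>R Pe - Pb) (at_right L)"
        by (intro tendsto_intros)
      show "\<forall>\<^sub>F l in at_right L. l *\<^sub>R Pe - Pb \<in> psd_cone"
        using eventually_at_right_less by (rule eventually_mono) (rule up)
    qed simp
    \<comment> \<open>The solution restarted at \<open>Pb\<close> is strictly below
      \<open>L *\<^sub>R Pe\<close> at time 1, and for a suitable \<open>k\<close> the original one
      follows it closely for one time unit after \<open>s (r k)\<close>.\<close>
    obtain X where X: "ric_solution X" "X 0 = Pb"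
      using ric_solution_exists[OF \<open>Pb \<in> psd_cone\<close> \<open>Pb \<noteq> 0\<close>] by blast
    have "pos_def (L *\<^sub>R Pe - X 1)"
      using ric_solution_comparison(2)[OF const[OF L0] X(1), of 1] le ne X(2) by simp
    then obtain d where d: "d > 0"
      "\<And>E. transpose E = E \<Longrightarrow> norm E \<le> d \<Longrightarrow> L *\<^sub>R Pe - X 1 + E \<in> psd_cone"
      using pos_def_perturb by blast
    obtain K where K: "\<And>Y P t. ric_solution Y \<Longrightarrow> ric_solution P \<Longrightarrow> t \<ge> 0 \<Longrightarrow>
      norm (Y t - P t) \<le> exp (K * t) * norm (Y 0 - P 0)"
      using ric_solution_lipschitz_dependence by blast
    have "\<forall>\<^sub>F k in sequentially. dist ((P \<circ> s \<circ> r) k) Pb < d / (2 * exp K)"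
      by (rule tendstoD[OF lim]) (use d in simp)
    then obtain k where k: "dist (P (s (r k))) Pb < d / (2 * exp K)"
      by (auto simp: eventually_sequentially)
    have "norm (X 1 - P (s (r k) + 1)) \<le> exp K * norm (Pb - P (s (r k)))"
      using K[OF X(1) ric_solution_shift[OF P sr0], of 1] X(2) by simp
    also have "\<dots> \<le> exp K * (d / (2 * exp K))"
      using k by (intro mult_left_mono) (auto simp: dist_norm norm_minus_commute)
    finally have close: "norm (X 1 - P (s (r k) + 1)) \<le> d / 2" by simp
    \<comment> \<open>The first bound keeps \<open>L - q\<close> positive; the second spends half of
      the margin \<open>d\<close> on \<open>q *\<^sub>R Pe\<close>, leaving half for the distance
      from \<open>X 1\<close>.\<close>
    define q where "q = min (L / 2) (d / (2 * norm Pe))"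
    have nPe: "norm Pe > 0" using pos_def_nonzero[OF Pe] by simp
    have q: "q > 0" "q < L" "q * norm Pe \<le> d / 2"
      using L0 d nPe by (auto simp: q_def min_def field_simps)
    have "L *\<^sub>R Pe - X 1 + (X 1 - P (s (r k) + 1) - q *\<^sub>R Pe) \<in> psd_cone"
    proof (rule d(2))
      show "transpose (X 1 - P (s (r k) + 1) - q *\<^sub>R Pe) = X 1 - P (s (r k) + 1) - q *\<^sub>R Pe"
        using ric_solutionD(4)[OF X(1), of 1] PD(4)[of "s (r k) + 1"] sr0[of k]
          psd_cone_transpose[OF pos_def_imp_psd_cone[OF Pe]]
        by (simp add: tp_simps)
      show "norm (X 1 - P (s (r k) + 1) - q *\<^sub>R Pe) \<le> d"
        using norm_triangle_ineq4[of "X 1 - P (s (r k) + 1)" "q *\<^sub>R Pe"] close q by simp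
    qed
    then have "L - q \<in> U"
      using q sr0[of k] by (auto simp: U_def scaleR_diff_left algebra_simps intro!: exI[of _ "s (r k) + 1"])
    then have "L \<le> L - q" unfolding L_def by (rule cInf_lower[OF _ Ubdd])
    then show False using q by simp
  qed
  then show thesis using that L0 by blast
qed

end

subsection \<open>Convergence in the Hilbert metric\<close>

text \<open>Every lower factor is at most every upper one, so the supremum and infimum lie between
  \<open>a\<close> and \<open>b\<close>; the infinite default is avoided and the logarithm is
  nonnegative.\<close>

lemma hilbert_metric_bounds:
  fixes X Y :: "real^'n^'n"
  assumes Y: "pos_def Y" and a: "0 < a" "X - a *\<^sub>R Y \<in> psd_cone" and b: "b *\<^sub>R Y - X \<in> psd_cone"
  shows "0 \<le> hilbert_metric X Y" "hilbert_metric X Y \<le> ereal (ln (b / a))"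
proof -
  have ul: "u \<le> l" if "l *\<^sub>R Y - X \<in> psd_cone" "X - u *\<^sub>R Y \<in> psd_cone" for u l
  proof -
    have "(l - u) *\<^sub>R Y \<in> psd_cone" using psd_cone_add[OF that] by (simp add: scaleR_diff_left)
    then show ?thesis using pos_def_scaleR_in_psd_cone_iff[OF Y] by simp
  qed
  have M: "hilbert_M X Y \<le> ereal b"
    unfolding hilbert_M_def loewner_le_def by (intro Inf_lower) (use b in auto)
  have m: "ereal a \<le> hilbert_m X Y"
    unfolding hilbert_m_def loewner_le_def by (intro Sup_upper) (use a in auto)
  have mM: "hilbert_m X Y \<le> hilbert_M X Y"
    unfolding hilbert_m_def hilbert_M_def loewner_le_def
    by (intro Sup_least Inf_greatest) (auto intro: ul)
  obtain Mr where Mr: "hilbert_M X Y = ereal Mr"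
    using M m mM by (cases "hilbert_M X Y") auto
  obtain mr where mr: "hilbert_m X Y = ereal mr"
    using M m mM Mr by (cases "hilbert_m X Y") auto
  have o: "a \<le> mr" "mr \<le> Mr" "Mr \<le> b" using M m mM by (auto simp: Mr mr)
  have h: "hilbert_metric X Y = ereal (ln (Mr / mr))"
    using o a by (auto simp: hilbert_metric_def Mr mr zero_ereal_def)
  have "1 \<le> Mr / mr" using o a by (simp add: le_divide_eq_1)
  then show "0 \<le> hilbert_metric X Y" by (simp add: h zero_ereal_def)
  have "Mr / mr \<le> b / a" using o a by (intro frac_le) auto
  then show "hilbert_metric X Y \<le> ereal (ln (b / a))"
    using \<open>1 \<le> Mr / mr\<close> by (simp add: h)
qed

text \<open>Norm convergence eventually squeezes \<open>P t\<close> between \<open>(L - d) Y\<close>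
  and \<open>(L + d) Y\<close>. The quotient of the two factors tends to 1 as \<open>d\<close> tends
  to 0, whatever \<open>L\<close> is.\<close>

lemma tendsto_imp_hilbert_metric_tendsto_zero:
  fixes P :: "real \<Rightarrow> real^'n^'n"
  assumes Y: "pos_def Y" and L: "L > 0" and lim: "(P \<longlongrightarrow> L *\<^sub>R Y) F"
    and sym: "\<forall>\<^sub>F t in F. transpose (P t) = P t"
  shows "((\<lambda>t. hilbert_metric (P t) Y) \<longlongrightarrow> 0) F"
proof (rule order_tendstoI)
  have bounds: "\<forall>\<^sub>F t in F. 0 \<le> hilbert_metric (P t) Y
      \<and> hilbert_metric (P t) Y \<le> ereal (ln ((L + d) / (L - d)))" if d: "0 < d" "d < L" for d
  proof -
    obtain e where e: "e > 0" "\<And>E. transpose E = E \<Longrightarrow> norm E \<le> e \<Longrightarrow> Y + E \<in> psd_cone"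
      using pos_def_perturb[OF Y] by blast
    have "\<forall>\<^sub>F t in F. dist (P t) (L *\<^sub>R Y) < d * e"
      using lim e d by (intro tendstoD) auto
    with sym show ?thesis
    proof eventually_elim
      case (elim t)
      \<comment> \<open>Division by \<open>d\<close> brings the error to the size tolerated by
        \<open>Y\<close>; multiplying back turns \<open>Y + E\<close> and \<open>Y - E\<close> into
        the two bounds.\<close>
      define E where "E = (1 / d) *\<^sub>R (P t - L *\<^sub>R Y)"
      have "norm E \<le> e"
        unfolding E_def norm_scaleR using elim d by (simp add: dist_norm field_simps)
      moreover have "transpose E = E"
        using elim psd_cone_transpose[OF pos_def_imp_psd_cone[OF Y]] by (simp add: E_def tp_simps)
      ultimately have "Y + E \<in> psd_cone" "Y + - E \<in> psd_cone"
        using e(2)[of E] e(2)[of "- E"] transpose_scaleR[of "-1" E] by auto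
      then have "d *\<^sub>R (Y + E) \<in> psd_cone" "d *\<^sub>R (Y + - E) \<in> psd_cone"
        using d by (auto intro!: psd_cone_scaleR)
      then have "P t - (L - d) *\<^sub>R Y \<in> psd_cone" "(L + d) *\<^sub>R Y - P t \<in> psd_cone"
        using d by (simp_all add: E_def algebra_simps)
      then show ?case using hilbert_metric_bounds[OF Y, of "L - d"] d by simp
    qed
  qed
  have "\<forall>\<^sub>F t in F. 0 \<le> hilbert_metric (P t) Y"
    using bounds[of "L / 2"] L by (auto elim: eventually_mono)
  then show "\<forall>\<^sub>F t in F. a < hilbert_metric (P t) Y" if "a < 0" for a
    by (rule eventually_mono) (use that in auto)
  show "\<forall>\<^sub>F t in F. hilbert_metric (P t) Y < a" if a: "a > 0" for a
  proof -
    obtain r where r: "0 < r" "ereal r < a"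
      using ereal_dense2[OF a] by (auto simp: zero_ereal_def)
    \<comment> \<open>This \<open>d\<close> solves \<open>(L + d) / (L - d) = exp r\<close>.\<close>
    define d where "d = L * (exp r - 1) / (exp r + 1)"
    have er: "exp r > 1" "1 + exp r \<noteq> 0" "exp r + 1 \<noteq> 0" "exp r + 1 > 0"
      using r exp_gt_zero[of r] by (simp, linarith+)
    have "L + d = 2 * L * exp r / (exp r + 1)" "L - d = 2 * L / (exp r + 1)"
      using er by (simp_all add: d_def field_simps)
    then have "(L + d) / (L - d) = exp r" using L er by simp
    moreover have "0 < d" using L er by (simp add: d_def)
    moreover have "d < L" using L er by (simp add: d_def pos_divide_less_eq algebra_simps)
    ultimately have "\<forall>\<^sub>F t in F. hilbert_metric (P t) Y \<le> ereal r"
      using bounds[of d] by (auto elim: eventually_mono)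
    then show ?thesis by (rule eventually_mono) (use r in auto)
  qed
qed

text \<open>The congruence of \<open>R\<close> by its own inverse is the inverse again, by symmetry
  of \<open>R\<close>.\<close>

lemma pos_def_matrix_inv_in_psd_cone:
  fixes R :: "real^'p^'p"
  assumes R: "pos_def R" shows "matrix_inv R \<in> psd_cone"
proof -
  have "R *v x = 0 \<Longrightarrow> x = 0" for x
    using R unfolding pos_def_def by (metis inner_zero_right less_irrefl)
  then have "invertible R"
    using matrix_left_invertible_ker invertible_left_inverse by blast
  then have inv: "R ** matrix_inv R = mat 1" "matrix_inv R ** R = mat 1"
    
    using someI_ex[of "\<lambda>X. R ** X = mat 1 \<and> X ** R = mat 1"] by (auto simp: invertible_def matrix_inv_def)
  have Rs: "transpose R = R" using R by (simp add: pos_def_def)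
  have "transpose (matrix_inv R) ** R ** matrix_inv R \<in> psd_cone"
    by (intro psd_cone_congruence pos_def_imp_psd_cone R)
  also have "transpose (matrix_inv R) ** R = transpose (R ** matrix_inv R)"
    by (simp add: matrix_transpose_mul Rs)
  finally show ?thesis by (simp add: inv)
qed

text \<open>The existence clause keeps the claim about all solutions from being vacuous; the cone
  clause puts the first argument of \<open>hilbert_metric\<close> in its intended domain.\<close>

theorem mainTheorem8:
  fixes A :: "real^'n^'n" and B :: "real^'p^'n" and C :: "real^'n^'m"
    and R :: "real^'p^'p" and P_sharp :: "real^'n^'n"
  assumes "pos_def R"
    and "controllable A B"
    and "observable A C"
    and "pos_def P_sharp"
    and "care A B C R P_sharp"
  shows "\<exists>\<alpha>>0. \<forall>P0 \<in> psd_cone - {0}.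
    (\<exists>P. scaled_riccati_solution A B C R \<alpha> P0 P) \<and>
    (\<forall>P. scaled_riccati_solution A B C R \<alpha> P0 P \<longrightarrow>
       (\<forall>t\<ge>0. P t \<in> psd_cone - {0}) \<and>
       ((\<lambda>t. hilbert_metric (P t) P_sharp) \<longlongrightarrow> 0) at_top)"
proof -
  define S where "S = B ** matrix_inv R ** transpose B"
  \<comment> \<open>At \<open>c *\<^sub>R P_sharp\<close> the quadratic term then has the factor
    \<open>c\<^sup>2 / (c trace P_sharp) = c \<alpha>\<close> and the forcing
    \<open>\<alpha>\<^sup>2 c trace P_sharp = c \<alpha>\<close>, so the algebraic equation factors
    out.\<close>
  define \<alpha> where "\<alpha> = 1 / trace P_sharp"
  have \<tau>: "trace P_sharp > 0" using assms by (intro pos_def_trace_pos)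
  then have \<alpha>: "\<alpha> > 0" by (simp add: \<alpha>_def)
  interpret trace_riccati A S C \<alpha>
  proof
    show "S \<in> psd_cone"
      using psd_cone_congruence[OF pos_def_matrix_inv_in_psd_cone[OF assms(1)], of "transpose B"]
      by (simp add: S_def)
  qed (use assms \<alpha> in auto)
  have sol: "scaled_riccati_solution A B C R \<alpha> P0 P \<longleftrightarrow>
      P 0 = P0 \<and> (\<forall>t\<ge>0. trace (P t) \<noteq> 0 \<and> (P has_vector_derivative ric (P t)) (at t within {0..}))" for P0 P
    unfolding ric_def unfolding S_def by (simp add: scaled_riccati_solution_def matrix_mul_assoc)
  have ray: "ric (c *\<^sub>R P_sharp) = 0" if c: "c > 0" for c
  proof -
    have "ric (c *\<^sub>R P_sharp) = (c * \<alpha>) *\<^sub>R (transpose A ** P_sharp + P_sharp ** A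
        - P_sharp ** S ** P_sharp + transpose C ** C)"
      unfolding ric_def using \<tau> c
      by (simp add: mm_simps trace_scaleR \<alpha>_def power2_eq_square scaleR_add_right scaleR_diff_right)
    then show ?thesis
      using assms(5) by (simp add: care_def S_def matrix_mul_assoc)
  qed
  show ?thesis
  proof (intro exI[of _ \<alpha>] conjI ballI allI impI \<alpha>)
    fix P0 :: "real^'n^'n" assume P0: "P0 \<in> psd_cone - {0}"
    then obtain P where "ric_solution P" "P 0 = P0"
      using ric_solution_exists[of P0] by auto
    then show "\<exists>P. scaled_riccati_solution A B C R \<alpha> P0 P"
      unfolding sol using ric_solutionD(3,5)[of P] by (metis less_irrefl)
    fix P assume "scaled_riccati_solution A B C R \<alpha> P0 P"
    then have P: "ric_solution P"
      using P0 unfolding sol by (intro ric_solutionI) auto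
    show "P t \<in> psd_cone - {0}" if "t \<ge> 0" for t
      using ric_solutionD(1,2)[OF P that] by simp
    obtain L where "L > 0" "(P \<longlongrightarrow> L *\<^sub>R P_sharp) at_top"
      using ric_solution_tendsto_ray[OF assms(4) ray P] by blast
    then show "((\<lambda>t. hilbert_metric (P t) P_sharp) \<longlongrightarrow> 0) at_top"
      by (rule tendsto_imp_hilbert_metric_tendsto_zero[OF assms(4)])
        (use ric_solutionD(4)[OF P] in \<open>auto simp: eventually_at_top_linorder\<close>)
  qed
qed

end
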